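(* Let $(Y, \|\cdot\|_Y)$ and $(U, \|\cdot\|_U)$ be real Banach spaces that are uniformly convex and uniformly smooth, let $p \in (1,\infty)$, and let $S\colon U \to Y$ be a function that is not affine-linear and that satisfies: whenever a sequence $(u_n)_{n\in\mathbb{N}} \subset U$ converges weakly in $U$ to some $u \in U$, the sequence $(S(u_n))_{n\in\mathbb{N}}$ converges weakly in $Y$ to $S(u)$. Then there exist a tuple $(y_d, u_d) \in Y \times U$, sequences $\{(y_{d,n}, u_{d,n})\}_{n \in \mathbb{N}} \subset Y \times U$ and $\{(y_{d,n}', u_{d,n}')\}_{n \in \mathbb{N}} \subset Y \times U$, and elements $(\bar y, \bar u) \in Y \times U$ and $(\bar y', \bar u') \in Y \times U$ such that the following is true: (i) $\{(y_{d,n}, u_{d,n})\}_{n \in \mathbb{N}}$ and $\{(y_{d,n}', u_{d,n}')\}_{n \in \mathbb{N}}$ converge strongly (i.e., in norm) in $Y \times U$ to $(y_d, u_d)$; (ii) for all $n \in \mathbb{N}$, $$\{(\bar y, \bar u)\} = \operatorname*{arg\,min}_{(y,u) \in Y \times U,\ y = S(u)} \|y-y_{d,n}\|_Y^p + \|u-u_{d,n}\|_U^p;$$ (iii) for all $n \in \mathbb{N}$, $$\{(\bar y', \bar u')\} = \operatorname*{arg\,min}_{(y,u) \in Y \times U,\ y = S(u)} \|y-y_{d,n}'\|_Y^p + \|u-u_{d,n}'\|_U^p;$$ (iv) $(\bar y, \bar u) \neq (\bar y', \bar u')$.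
   Context: Here $\operatorname*{arg\,min}$ denotes the set of all global minimizers. A function $S\colon U \to Y$ is called affine-linear if there exist a linear map $L\colon U \to Y$ and an element $c \in Y$ with $S(u) = L u + c$ for all $u \in U$. *)

theory Defs
  imports "HOL-Analysis.Analysis"
begin

definition uniformly_convex :: "'a::real_normed_vector itself \<Rightarrow> bool" where
  "uniformly_convex _ \<longleftrightarrow>
    (\<forall>\<epsilon>>0. \<exists>\<delta>>0. \<forall>x y :: 'a.
       norm x = 1 \<longrightarrow> norm y = 1 \<longrightarrow> norm (x - y) \<ge> \<epsilon> \<longrightarrow>
       norm ((1/2) *\<^sub>R (x + y)) \<le> 1 - \<delta>)"

text \<open>
  Equivalently, the modulus of smoothness
  \<open>\<rho>(\<tau>) = sup {(\<parallel>x + y\<parallel> + \<parallel>x - y\<parallel>)/2 - 1 | \<parallel>x\<parallel> = 1, \<parallel>y\<parallel> = \<tau>}\<close>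
  satisfies \<open>\<rho>(\<tau>)/\<tau> \<rightarrow> 0\<close> as \<open>\<tau>\<close> tends to \<open>0\<close> from the right.
\<close>
definition uniformly_smooth :: "'a::real_normed_vector itself \<Rightarrow> bool" where
  "uniformly_smooth _ \<longleftrightarrow>
    (\<forall>\<epsilon>>0. \<exists>\<delta>>0. \<forall>x y :: 'a.
       norm x = 1 \<longrightarrow> norm y \<le> \<delta> \<longrightarrow>
       norm (x + y) + norm (x - y) \<le> 2 + \<epsilon> * norm y)"

definition weakly_converges ::
    "(nat \<Rightarrow> 'a::real_normed_vector) \<Rightarrow> 'a \<Rightarrow> bool" where
  "weakly_converges x l \<longleftrightarrow>
    (\<forall>f :: 'a \<Rightarrow> real. bounded_linear f \<longrightarrow> (\<lambda>n. f (x n)) \<longlonglongrightarrow> f l)"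

text \<open>The linear part is not required to be bounded.\<close>
definition affine_linear ::
    "('a::real_vector \<Rightarrow> 'b::real_vector) \<Rightarrow> bool" where
  "affine_linear S \<longleftrightarrow> (\<exists>L c. linear L \<and> (\<forall>u. S u = L u + c))"

definition argmin_set :: "('a \<Rightarrow> real) \<Rightarrow> ('a \<Rightarrow> bool) \<Rightarrow> 'a set" where
  "argmin_set f P = {x. is_arg_min f P x}"

end

theory Submission
  imports Defs "HOL-Complex_Analysis.Great_Picard"
begin

text \<open>
  With \<open>N (y, u) = (\<parallel>y\<parallel>\<^sup>p + \<parallel>u\<parallel>\<^sup>p)\<^sup>1\<^sup>/\<^sup>p\<close>, the minimizers are the \<open>N\<close>-nearest points on the
  graph of \<open>S\<close>. The graph is not convex, since \<open>S\<close> is not affine-linear, so by Vlasov's theorem on Chebyshev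
  sets some point \<open>x = (y\<^sub>d, u\<^sub>d)\<close> has two distinct nearest points \<open>a\<close> and \<open>b\<close> on it. By strict convexity
  of \<open>N\<close>, every point of the open segment from \<open>x\<close> to \<open>a\<close> has \<open>a\<close> as its only nearest point, and
  likewise for \<open>b\<close>; the two sequences approach \<open>x\<close> along these segments.

  Vlasov's theorem: if nearest points are unique, they depend continuously on \<open>x\<close>, and the
  distance to the set grows at rate almost \<open>1\<close> in the direction away from the nearest point. By an
  Ekeland-type argument one can therefore move any prescribed distance \<open>R\<close> from \<open>x\<^sub>0\<close>, a point between
  two points of the set, while increasing the distance to the set by almost \<open>R\<close>. For large \<open>R\<close> this
  contradicts uniform smoothness.

  Hahn-Banach and Eberlein-Smulian are not needed: smoothness provides norming functionals as
  directional derivatives of the norm, and countably many of them identify the weak limit among the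
  common points of the closed convex hulls of the tails, which exist by uniform convexity.
\<close>

subsection \<open>Powers and uniformly smooth norms\<close>

text \<open>Otherwise some subsequence stays a fixed distance away from \<open>L\<close>, and none
  of its subsequences can converge to \<open>L\<close>. This turns compactness plus uniqueness of
  limits into convergence.\<close>

lemma subseq_criterion:
  fixes X :: "nat \<Rightarrow> 'a::metric_space"
  assumes "\<And>s :: nat \<Rightarrow> nat. strict_mono s \<Longrightarrow> \<exists>r. strict_mono r \<and> (\<lambda>n. X (s (r n))) \<longlonglongrightarrow> L"
  shows "X \<longlonglongrightarrow> L"
proof (rule ccontr)
  assume "\<not> X \<longlonglongrightarrow> L"
  then obtain e where e: "e > 0" "\<And>N. \<exists>n\<ge>N. dist (X n) L \<ge> e"
    unfolding lim_sequentially by (metis not_le)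
  then have "infinite {n. dist (X n) L \<ge> e}"
    by (auto simp: infinite_nat_iff_unbounded_le)
  then obtain s :: "nat \<Rightarrow> nat" where s: "strict_mono s" "\<And>n. dist (X (s n)) L \<ge> e"
    using infinite_enumerate by blast
  then obtain r where "(\<lambda>n. X (s (r n))) \<longlonglongrightarrow> L"
    using assms by blast
  then have "\<forall>\<^sub>F n in sequentially. dist (X (s (r n))) L < e"
    using e tendstoD by blast
  then show False
    using s(2) by (auto simp: eventually_sequentially not_less[symmetric])
qed

text \<open>Subtracting the linear term leaves \<open>g\<close>, whose derivative at
  \<open>t > 0\<close> has the sign of \<open>t - a\<close>. Continuity of \<open>g\<close> up to 0
  covers the cases where \<open>a\<close> or \<open>s\<close> vanishes.\<close>

lemma powr_tangent_strict:
  fixes a s p :: real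
  assumes "1 < p" "0 \<le> a" "0 \<le> s" "s \<noteq> a"
  shows "a powr p + p * a powr (p - 1) * (s - a) < s powr p"
proof -
  define g where "g t = t powr p - p * a powr (p - 1) * t" for t
  have d: "(g has_real_derivative p * (t powr (p - 1) - a powr (p - 1))) (at t)" if "t > 0" for t
    unfolding g_def using that
    by (auto intro!: derivative_eq_intros simp: algebra_simps)
  have c: "continuous_on {0..} g"
    unfolding g_def using assms by (intro continuous_on_diff continuous_on_powr' continuous_intros) auto
  have "g a < g s"
  proof (cases "a < s")
    case True
    have "continuous_on {a..s} g"
      by (rule continuous_on_subset[OF c]) (use assms in auto)
    moreover have "\<exists>y. (g has_real_derivative y) (at x) \<and> y > 0" if "a < x" "x < s" for x
      using d[of x] that assms powr_less_mono2[of "p-1" a x] by force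
    ultimately show ?thesis
      using DERIV_pos_imp_increasing_open[OF True, of g] by blast
  next
    case False
    then have sa: "s < a" using assms by simp
    have "continuous_on {s..a} g"
      by (rule continuous_on_subset[OF c]) (use assms in auto)
    moreover have "\<exists>y. (g has_real_derivative y) (at x) \<and> y < 0" if "s < x" "x < a" for x
      using d[of x] that assms powr_less_mono2[of "p-1" x a] 
      by (intro exI[of _ "p * (x powr (p - 1) - a powr (p - 1))"]) (auto simp: mult_pos_neg)
    ultimately show ?thesis
      using DERIV_neg_imp_decreasing_open[OF sa, of g] by blast
  qed
  then show ?thesis
    by (simp add: g_def algebra_simps)
qed

lemma powr_tangent:
  fixes a s p :: real
  assumes "1 < p" "0 \<le> a" "0 \<le> s"
  shows "a powr p + p * a powr (p - 1) * (s - a) \<le> s powr p"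
  using powr_tangent_strict[of p a s] assms by (cases "s = a") auto

text \<open>The tangent at the combination \<open>m\<close> lies below the power at \<open>a\<close>
  and at \<open>b\<close>; in the weighted sum the linear terms cancel.\<close>

lemma powr_convex_comb:
  fixes a b p t :: real
  assumes "1 < p" "0 \<le> a" "0 \<le> b" "0 \<le> t" "t \<le> 1"
  shows "((1 - t) * a + t * b) powr p \<le> (1 - t) * a powr p + t * b powr p"
proof -
  define m where "m = (1 - t) * a + t * b"
  have m: "0 \<le> m" using assms by (auto simp: m_def)
  have "(1 - t) * (m powr p + p * m powr (p - 1) * (a - m)) + t * (m powr p + p * m powr (p - 1) * (b - m))
     \<le> (1 - t) * a powr p + t * b powr p"
    by (intro add_mono mult_left_mono powr_tangent) (use assms m in auto)
  also have "(1 - t) * (m powr p + p * m powr (p - 1) * (a - m)) + t * (m powr p + p * m powr (p - 1) * (b - m))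
     = m powr p + p * m powr (p - 1) * ((1 - t) * a + t * b - m)"
    by (simp add: algebra_simps)
  finally show ?thesis by (simp add: m_def)
qed

lemma powr_midpoint_strict:
  fixes a b p :: real
  assumes "1 < p" "0 \<le> a" "0 \<le> b" "a \<noteq> b"
  shows "((a + b) / 2) powr p < (a powr p + b powr p) / 2"
proof -
  define m where "m = (a + b) / 2"
  have "m powr p + p * m powr (p - 1) * (a - m) < a powr p"
       "m powr p + p * m powr (p - 1) * (b - m) < b powr p"
    by (intro powr_tangent_strict; use assms in \<open>auto simp: m_def\<close>)+
  moreover have "p * m powr (p - 1) * (a - m) + p * m powr (p - 1) * (b - m) = 0"
    by (simp add: m_def field_simps)
  ultimately show ?thesis by (simp add: m_def)
qed

text \<open>The tangent inequality based at \<open>s\<close> bounds the error by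
  \<open>p * (s powr (p - 1) - a powr (p - 1)) * (s - a)\<close>, and the power \<open>p - 1\<close>
  is uniformly continuous on the compact interval from 0 to 2.\<close>

lemma powr_tangent_upper:
  fixes p e :: real
  assumes "1 < p" "0 < e"
  shows "\<exists>d>0. \<forall>a s. 0 \<le> a \<longrightarrow> a \<le> 1 \<longrightarrow> 0 \<le> s \<longrightarrow> \<bar>s - a\<bar> \<le> d \<longrightarrow>
     s powr p \<le> a powr p + p * a powr (p - 1) * (s - a) + e * \<bar>s - a\<bar>"
proof -
  have "uniformly_continuous_on {0..2} (\<lambda>t::real. t powr (p - 1))"
    by (intro compact_uniformly_continuous continuous_on_powr' continuous_intros) (use assms in auto)
  moreover have "e / p > 0" using assms by auto
  ultimately obtain d where d: "d > 0" 
    "\<And>a s. \<lbrakk>a \<in> {0..2}; s \<in> {0..2}; \<bar>s - a\<bar> < d\<rbrakk> \<Longrightarrow> \<bar>s powr (p - 1) - a powr (p - 1)\<bar> < e / p"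
    unfolding uniformly_continuous_on_def dist_real_def by meson
  show ?thesis
  \<comment> \<open>The bound 1 keeps \<open>s\<close> below 2; halving \<open>d\<close> makes the
    distance strictly smaller than \<open>d\<close>.\<close>
  proof (intro exI[of _ "min 1 (d / 2)"] conjI allI impI)
    fix a s :: real
    assume as: "0 \<le> a" "a \<le> 1" "0 \<le> s" "\<bar>s - a\<bar> \<le> min 1 (d / 2)"
    have "\<bar>s powr (p - 1) - a powr (p - 1)\<bar> \<le> e / p"
      using as d by (intro less_imp_le d(2)) auto
    then have "p * \<bar>s powr (p - 1) - a powr (p - 1)\<bar> \<le> e"
      using assms by (simp add: field_simps)
    then have "p * \<bar>s powr (p - 1) - a powr (p - 1)\<bar> * \<bar>s - a\<bar> \<le> e * \<bar>s - a\<bar>"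
      by (rule mult_right_mono) auto
    moreover have "p * (s powr (p - 1) - a powr (p - 1)) * (s - a)
        \<le> p * \<bar>s powr (p - 1) - a powr (p - 1)\<bar> * \<bar>s - a\<bar>"
      using mult_left_mono[OF abs_ge_self[of "(s powr (p - 1) - a powr (p - 1)) * (s - a)"], of p] assms
      by (simp add: abs_mult mult.assoc)
    ultimately have "p * (s powr (p - 1) - a powr (p - 1)) * (s - a) \<le> e * \<bar>s - a\<bar>"
      by linarith
    moreover have "s powr p + p * s powr (p - 1) * (a - s) \<le> a powr p"
      using powr_tangent[of p s a] as assms by auto
    ultimately show "s powr p \<le> a powr p + p * a powr (p - 1) * (s - a) + e * \<bar>s - a\<bar>"
      by (simp add: algebra_simps)
  qed (use d in auto)
qed

lemma uniformly_smooth_scaled: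
  assumes "uniformly_smooth TYPE('a::real_normed_vector)" "e > 0"
  shows "\<exists>d>0. \<forall>x y :: 'a. norm y \<le> d * norm x \<longrightarrow> norm (x + y) + norm (x - y) \<le> 2 * norm x + e * norm y"
proof -
  obtain d where d: "d > 0"
    "\<And>x y :: 'a. \<lbrakk>norm x = 1; norm y \<le> d\<rbrakk> \<Longrightarrow> norm (x + y) + norm (x - y) \<le> 2 + e * norm y"
    using assms unfolding uniformly_smooth_def by blast
  have "norm (x + y) + norm (x - y) \<le> 2 * norm x + e * norm y" if "norm y \<le> d * norm x" for x y :: 'a
  proof (cases "x = 0")
    case False
    define r where "r = norm x"
    have r: "r > 0" using False by (simp add: r_def)
    have "norm (x /\<^sub>R r + y /\<^sub>R r) + norm (x /\<^sub>R r - y /\<^sub>R r) \<le> 2 + e * norm (y /\<^sub>R r)"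
      by (rule d(2)) (use r that in \<open>auto simp: r_def field_simps\<close>)
    then have "norm (x + y) / r + norm (x - y) / r \<le> 2 + e * (norm y / r)"
      using r by (simp flip: scaleR_right_distrib scaleR_right_diff_distrib add: divide_inverse mult_ac)
    then have "(norm (x + y) / r + norm (x - y) / r) * r \<le> (2 + e * (norm y / r)) * r"
      using r by (intro mult_right_mono) auto
    then show ?thesis using r by (simp add: r_def[symmetric] distrib_right)
  qed (use that in simp)
  then show ?thesis using d(1) by blast
qed

text \<open>The norm is not smooth at 0, but its \<open>p\<close>-th power is. The first-order terms
  add up to \<open>p * a powr (p - 1) * (s + t - 2 * a)\<close>: away from 0 uniform smoothness
  controls the last factor, and near 0 the power of \<open>a\<close> is small.\<close>

lemma powr_norm_smooth:
  fixes p e :: real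
  assumes "uniformly_smooth TYPE('a::real_normed_vector)" "1 < p" "0 < e"
  shows "\<exists>d>0. \<forall>x k :: 'a. norm x \<le> 1 \<longrightarrow> norm k \<le> d \<longrightarrow>
     norm (x + k) powr p + norm (x - k) powr p \<le> 2 * norm x powr p + e * norm k"
proof -
  \<comment> \<open>Half of \<open>e\<close> is reserved for the first-order terms, which carry a
    factor \<open>p\<close>; the other half pays for the two remainders with
    \<open>e / 4\<close>.\<close>
  define e2 where "e2 = e / (2 * p)"
  have e2: "e2 > 0" using assms by (simp add: e2_def)
  obtain d1 where d1: "d1 > 0" "\<And>a s. \<lbrakk>0 \<le> a; a \<le> 1; 0 \<le> s; \<bar>s - a\<bar> \<le> d1\<rbrakk> \<Longrightarrow>
     s powr p \<le> a powr p + p * a powr (p - 1) * (s - a) + e / 4 * \<bar>s - a\<bar>"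
    using powr_tangent_upper[of p "e / 4"] assms by auto
  obtain d2 where d2: "d2 > 0" "\<And>x y :: 'a. norm y \<le> d2 * norm x \<Longrightarrow> norm (x + y) + norm (x - y) \<le> 2 * norm x + e2 * norm y"
    using uniformly_smooth_scaled[OF assms(1) e2] by blast
  \<comment> \<open>\<open>h\<close> separates the two cases: below it,
    \<open>a powr (p - 1)\<close> is at most \<open>e2 / 2\<close>, which suffices with the crude
    bound \<open>2 * norm k\<close> for \<open>s + t - 2 * a\<close>.\<close>
  define h where "h = (e2 / 2) powr (1 / (p - 1))"
  have h: "h > 0" "h powr (p - 1) = e2 / 2" using e2 assms by (auto simp: h_def powr_powr)
  show ?thesis
  proof (intro exI[of _ "min d1 (d2 * h)"] conjI allI impI)
    fix x k :: 'a
    assume x: "norm x \<le> 1" and k: "norm k \<le> min d1 (d2 * h)"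
    define a s t where "a = norm x" and "s = norm (x + k)" and "t = norm (x - k)"
    have sa: "\<bar>s - a\<bar> \<le> norm k" and ta: "\<bar>t - a\<bar> \<le> norm k"
      using norm_triangle_ineq3[of "x + k" x] norm_triangle_ineq3[of "x - k" x] by (auto simp: a_def s_def t_def)
    have pos: "0 \<le> a" "a \<le> 1" "0 \<le> s" "0 \<le> t" using x by (auto simp: a_def s_def t_def)
    have "s powr p \<le> a powr p + p * a powr (p - 1) * (s - a) + e / 4 * \<bar>s - a\<bar>"
         "t powr p \<le> a powr p + p * a powr (p - 1) * (t - a) + e / 4 * \<bar>t - a\<bar>"
      using pos sa ta k by (intro d1(2); linarith)+
    moreover have "e / 4 * \<bar>s - a\<bar> \<le> e / 4 * norm k" "e / 4 * \<bar>t - a\<bar> \<le> e / 4 * norm k"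
      using sa ta assms by (auto intro!: mult_left_mono)
    moreover have "a powr (p - 1) * (s + t - 2 * a) \<le> e2 * norm k"
    proof (cases "a < h")
      case True
      then have "a powr (p - 1) \<le> e2 / 2"
        using h(2) powr_mono2[of "p - 1" a h] pos assms by auto
      then have "a powr (p - 1) * (s + t - 2 * a) \<le> e2 / 2 * (2 * norm k)"
        using sa ta e2 by (intro order.trans[OF mult_left_mono mult_right_mono]) auto
      then show ?thesis by simp
    next
      case False
      then have "d2 * h \<le> d2 * norm x" using d2(1) by (auto simp: a_def)
      then have "norm k \<le> d2 * norm x" using k by linarith
      from d2(2)[OF this] have "s + t - 2 * a \<le> e2 * norm k" by (simp add: s_def t_def a_def)
      moreover have "a powr (p - 1) \<le> 1" using pos powr_mono2[of "p - 1" a 1] assms by auto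
      ultimately have "a powr (p - 1) * (s + t - 2 * a) \<le> 1 * (e2 * norm k)"
        using e2 by (intro order.trans[OF mult_left_mono mult_right_mono]) auto
      then show ?thesis by simp
    qed
    then have "p * (a powr (p - 1) * (s + t - 2 * a)) \<le> p * (e2 * norm k)"
      using assms by (intro mult_left_mono) auto
    moreover have "p * (e2 * norm k) = e / 2 * norm k" using assms by (simp add: e2_def)
    moreover have "p * (a powr (p - 1) * (s + t - 2 * a))
        = p * a powr (p - 1) * (s - a) + p * a powr (p - 1) * (t - a)"
      by (simp add: algebra_simps)
    ultimately show "norm (x + k) powr p + norm (x - k) powr p \<le> 2 * norm x powr p + e * norm k"
      unfolding s_def[symmetric] t_def[symmetric] a_def[symmetric] by linarith
  qed (use d1 d2 h in auto)
qed

subsection \<open>Weak convergence in uniformly convex and uniformly smooth spaces\<close>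

text \<open>\<open>D\<close> is the one-sided directional derivative of the norm at
  \<open>x\<close>, written as an infimum because the quotient \<open>q\<close> increases with
  \<open>t\<close>. Convexity of the norm makes \<open>D\<close> sublinear, and smoothness makes it
  odd, hence linear.\<close>

lemma support_functional:
  fixes x :: "'a::real_normed_vector"
  assumes "uniformly_smooth TYPE('a)"
  shows "\<exists>f. bounded_linear f \<and> f x = norm x \<and> (\<forall>z. \<bar>f z\<bar> \<le> norm z)"
proof (cases "x = 0")
  case True
  then show ?thesis by (intro exI[of _ "\<lambda>_. 0"]) auto
next
  case False
  define q where "q t h = (norm (x + t *\<^sub>R h) - norm x) / t" for t h
  define D where "D h = (INF t\<in>{0<..}. q t h)" for h
  have q_bound: "\<bar>q t h\<bar> \<le> norm h" if "t > 0" for t h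
    using norm_triangle_ineq3[of "x + t *\<^sub>R h" x] that by (simp add: q_def field_simps)
  have bdd: "bdd_below ((\<lambda>t. q t h) ` {0<..})" for h
    using q_bound[of _ h] unfolding abs_le_iff by (intro bdd_belowI2[of _ "- norm h"]) (simp add: minus_le_iff)
  have D_le: "D h \<le> q t h" if "t > 0" for t h
    unfolding D_def using that by (intro cINF_lower bdd) auto
  have D_ge: "c \<le> D h" if "\<And>t. t > 0 \<Longrightarrow> c \<le> q t h" for c h
    unfolding D_def by (intro cINF_greatest) (use that in auto)
  have q_mono: "q s h \<le> q t h" if "0 < s" "s \<le> t" for s t h
  proof -
    have eq: "x + s *\<^sub>R h = (1 - s / t) *\<^sub>R x + (s / t) *\<^sub>R (x + t *\<^sub>R h)"
      using that by (simp add: algebra_simps)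
    have "norm (x + s *\<^sub>R h) \<le> norm ((1 - s / t) *\<^sub>R x) + norm ((s / t) *\<^sub>R (x + t *\<^sub>R h))"
      unfolding eq by (rule norm_triangle_ineq)
    also have "\<dots> = (1 - s / t) * norm x + s / t * norm (x + t *\<^sub>R h)"
      using that by simp
    finally have "norm (x + s *\<^sub>R h) - norm x \<le> s / t * (norm (x + t *\<^sub>R h) - norm x)"
      by (simp add: algebra_simps)
    then show ?thesis using that by (simp add: q_def field_simps)
  qed
  have D_lim: "\<exists>T>0. \<forall>t. 0 < t \<longrightarrow> t \<le> T \<longrightarrow> q t h < D h + e" if "e > 0" for h e
  proof -
    have "\<exists>T\<in>{0<..}. q T h < D h + e"
      unfolding D_def using that bdd by (intro iffD1[OF cINF_less_iff]) auto
    then show ?thesis using q_mono[of _ _ h] by (auto intro: le_less_trans)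
  qed
  have sub: "D (h + k) \<le> D h + D k" for h k
  proof (rule field_le_epsilon)
    fix e :: real assume "e > 0"
    then have e2: "e / 2 > 0" by simp
    obtain T1 where T1: "T1 > 0" "\<And>t. \<lbrakk>0 < t; t \<le> T1\<rbrakk> \<Longrightarrow> q t h < D h + e / 2"
      using D_lim[OF e2] by blast
    obtain T2 where T2: "T2 > 0" "\<And>t. \<lbrakk>0 < t; t \<le> T2\<rbrakk> \<Longrightarrow> q t k < D k + e / 2"
      using D_lim[OF e2] by blast
    \<comment> \<open>At this \<open>t\<close> both quotients are nearly \<open>D\<close>. Since
      \<open>x + (t / 2) *\<^sub>R (h + k)\<close> is the midpoint of
      \<open>x + t *\<^sub>R h\<close> and \<open>x + t *\<^sub>R k\<close>, the triangle inequality
      compares the three quotients.\<close>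
    define t where "t = min T1 T2"
    have t: "t > 0" "t \<le> T1" "t \<le> T2" using T1 T2 by (auto simp: t_def)
    have "2 * norm (x + (t / 2) *\<^sub>R (h + k)) = norm ((x + t *\<^sub>R h) + (x + t *\<^sub>R k))"
    proof -
      have "(x + t *\<^sub>R h) + (x + t *\<^sub>R k) = 2 *\<^sub>R (x + (t / 2) *\<^sub>R (h + k))"
        by (simp add: algebra_simps scaleR_2)
      then show ?thesis by simp
    qed
    also have "\<dots> \<le> norm (x + t *\<^sub>R h) + norm (x + t *\<^sub>R k)"
      by (rule norm_triangle_ineq)
    finally have "(2 * norm (x + (t / 2) *\<^sub>R (h + k)) - 2 * norm x) / t
        \<le> (norm (x + t *\<^sub>R h) + norm (x + t *\<^sub>R k) - 2 * norm x) / t"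
      using t by (intro divide_right_mono) auto
    then have "q (t / 2) (h + k) \<le> q t h + q t k"
      by (simp add: q_def diff_divide_distrib add_divide_distrib mult.commute)
    moreover have "D (h + k) \<le> q (t / 2) (h + k)" using t by (intro D_le) auto
    ultimately show "D (h + k) \<le> D h + D k + e"
      using T1(2)[OF t(1,2)] T2(2)[OF t(1,3)] by linarith
  qed
  have D_neg: "D (- h) = - D h" for h
  proof -
    have "D 0 = 0" using D_le[of 1 0] D_ge[of 0 0] by (auto simp: q_def)
    then have "0 \<le> D h + D (- h)" using sub[of h "- h"] by simp
    moreover have "D h + D (- h) \<le> 0"
    proof (rule field_le_epsilon)
      fix e :: real assume e: "e > 0"
      define e' where "e' = e / (norm h + 1)"
      have e': "e' > 0" "e' * norm h \<le> e" using e by (auto simp: e'_def field_simps add_pos_nonneg)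
      obtain d where d: "d > 0"
        "\<And>x y :: 'a. norm y \<le> d * norm x \<Longrightarrow> norm (x + y) + norm (x - y) \<le> 2 * norm x + e' * norm y"
        using uniformly_smooth_scaled[OF assms e'(1)] by blast
      \<comment> \<open>This step is short enough for uniform smoothness to apply to
        \<open>t *\<^sub>R h\<close>; the summand 1 avoids division by 0 when
        \<open>h = 0\<close>.\<close>
      define t where "t = d * norm x / (norm h + 1)"
      have t: "t > 0" using False d(1) by (simp add: t_def add_nonneg_pos)
      have "t * norm h \<le> t * (norm h + 1)" using t by (intro mult_left_mono) auto
      also have "\<dots> = d * norm x" by (simp add: t_def add_nonneg_eq_0_iff)
      finally have "norm (x + t *\<^sub>R h) + norm (x - t *\<^sub>R h) \<le> 2 * norm x + e' * norm (t *\<^sub>R h)"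
        using t by (intro d(2)) auto
      then have "(norm (x + t *\<^sub>R h) + norm (x - t *\<^sub>R h) - 2 * norm x) / t \<le> e' * norm h"
        using t by (simp add: pos_divide_le_eq mult_ac)
      then have "q t h + q t (- h) \<le> e' * norm h"
        by (simp add: q_def diff_divide_distrib add_divide_distrib mult.commute)
      then show "D h + D (- h) \<le> 0 + e"
        using D_le[OF t, of h] D_le[OF t, of "- h"] e'(2) by linarith
    qed
    ultimately show ?thesis by linarith
  qed
  have scale_le: "D (c *\<^sub>R h) \<le> c * D h" if c: "c > 0" for c h
  proof -
    have "D (c *\<^sub>R h) / c \<le> D h"
    proof (rule D_ge)
      fix t :: real assume t: "t > 0"
      have "D (c *\<^sub>R h) \<le> q (t / c) (c *\<^sub>R h)" using t c by (intro D_le) auto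
      also have "\<dots> = c * q t h" using c by (simp add: q_def)
      finally show "D (c *\<^sub>R h) / c \<le> q t h" using c by (simp add: field_simps)
    qed
    then show ?thesis using c by (simp add: field_simps)
  qed
  have scale_pos: "D (c *\<^sub>R h) = c * D h" if c: "c > 0" for c h
  proof (rule order_antisym[OF scale_le[OF c]])
    show "c * D h \<le> D (c *\<^sub>R h)"
      using scale_le[of "1 / c" "c *\<^sub>R h"] c by (simp add: field_simps)
  qed
  have scale: "D (c *\<^sub>R h) = c * D h" for c h
  proof (cases "c > 0")
    case False
    show ?thesis
    proof (cases "c = 0")
      case True
      then show ?thesis using D_neg[of 0] by simp
    next
      case c: False
      then show ?thesis using scale_pos[of "- c" h] D_neg[of "c *\<^sub>R h"] False by simp
    qed
  qed (rule scale_pos)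
  have D_add: "D (h + k) = D h + D k" for h k
    using sub[of h k] sub[of "- h" "- k"] D_neg[of h] D_neg[of k] D_neg[of "h + k"] by simp
  have bound: "\<bar>D h\<bar> \<le> norm h" for h
    using D_le[of 1 h] q_bound[of 1 h] D_le[of 1 "- h"] q_bound[of 1 "- h"] D_neg[of h]
    unfolding abs_le_iff norm_minus_cancel by linarith
  have "q t x = norm x" if "t > 0" for t
  proof -
    have eq: "x + t *\<^sub>R x = (1 + t) *\<^sub>R x" by (simp add: algebra_simps)
    have "norm (x + t *\<^sub>R x) = (1 + t) * norm x" unfolding eq norm_scaleR using that by simp
    then show ?thesis using that by (simp add: q_def algebra_simps)
  qed
  then have "D x = norm x" using D_le[of 1 x] D_ge[of "norm x" x] by force
  moreover have "bounded_linear D"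
    by (rule bounded_linear_intro[of _ 1]) (simp_all add: D_add scale bound)
  ultimately show ?thesis using bound by blast
qed

section \<open>Uniform convexity and nested convex sets\<close>

text \<open>Normalizing \<open>x\<close> and \<open>y\<close> and rescaling to length
  \<open>r\<close> moves each by at most \<open>3 * d\<close>, which reduces the claim to unit
  vectors. For \<open>r = 0\<close> both vectors are simply short.\<close>

lemma uniformly_convexD:
  fixes r e :: real
  assumes uc: "uniformly_convex TYPE('a::real_normed_vector)" and r: "0 \<le> r" and e: "0 < e"
  shows "\<exists>d>0. \<forall>x y :: 'a. norm x \<le> r + d \<longrightarrow> norm y \<le> r + d \<longrightarrow>
           r - d \<le> norm ((1/2) *\<^sub>R (x + y)) \<longrightarrow> norm (x - y) < e"
proof (cases "r = 0")
  case True
  have "norm (x - y) < e" if "norm x \<le> e / 3" "norm y \<le> e / 3" for x y :: 'a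
    using norm_triangle_ineq4[of x y] that e by linarith
  then show ?thesis using e True by (intro exI[of _ "e / 3"]) auto
next
  case False
  with r have r: "r > 0" by simp
  obtain d0 where d0: "d0 > 0" "\<And>x y :: 'a. \<lbrakk>norm x = 1; norm y = 1; e / (2 * r) \<le> norm (x - y)\<rbrakk>
      \<Longrightarrow> norm ((1/2) *\<^sub>R (x + y)) \<le> 1 - d0"
    using uc e r unfolding uniformly_convex_def by (metis divide_pos_pos mult_pos_pos zero_less_numeral)
  \<comment> \<open>The bound \<open>r / 4\<close> keeps \<open>r - 3 * d\<close> positive,
    \<open>e / 13\<close> gives \<open>6 * d + e / 2 < e\<close>, and \<open>d0 * r / 5\<close>
    contradicts \<open>d0 * r \<le> 4 * d\<close>, which would follow if the unit vectors were far
    apart.\<close>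
  define d where "d = min (r / 4) (min (e / 13) (d0 * r / 5))"
  have d: "d > 0" "d \<le> r / 4" "d \<le> e / 13" "d \<le> d0 * r / 5" using r e d0 by (auto simp: d_def)
  have "norm (x - y) < e" if x: "norm x \<le> r + d" and y: "norm y \<le> r + d"
    and xy: "r - d \<le> norm ((1/2) *\<^sub>R (x + y))" for x y :: 'a
  proof -
    have xy2: "2 * (r - d) \<le> norm (x + y)"
      using xy unfolding norm_scaleR by simp
    then have "2 * (r - d) \<le> norm x + norm y" using norm_triangle_ineq[of x y] by linarith
    then have low: "r - 3 * d \<le> norm x" "r - 3 * d \<le> norm y" using x y by simp_all
    then have pos: "norm x > 0" "norm y > 0" using d r by auto
    define x' y' where "x' = sgn x" and "y' = sgn y"
    have unit: "norm x' = 1" "norm y' = 1" using pos by (auto simp: x'_def y'_def norm_sgn)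
    have "x - r *\<^sub>R x' = (norm x - r) *\<^sub>R x'" "y - r *\<^sub>R y' = (norm y - r) *\<^sub>R y'"
      using pos by (auto simp: x'_def y'_def sgn_div_norm algebra_simps)
    then have close: "norm (x - r *\<^sub>R x') \<le> 3 * d" "norm (y - r *\<^sub>R y') \<le> 3 * d"
      using unit x y low d by (auto simp: abs_le_iff)
    have "norm (x' - y') < e / (2 * r)"
    proof (rule ccontr)
      assume "\<not> ?thesis"
      then have "norm ((1/2) *\<^sub>R (x' + y')) \<le> 1 - d0" using unit by (intro d0(2)) auto
      then have mid: "norm (x' + y') \<le> 2 * (1 - d0)" by simp
      have split: "x + y = (x - r *\<^sub>R x') + (y - r *\<^sub>R y') + r *\<^sub>R (x' + y')"
        by (simp add: algebra_simps)
      have "norm (x + y) \<le> 3 * d + 3 * d + r * (2 * (1 - d0))"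
        unfolding split by (intro norm_triangle_mono close) (use mid r in simp)
      then have "2 * (r - d) \<le> 6 * d + 2 * r - 2 * (d0 * r)" using xy2 by (simp add: algebra_simps)
      moreover have "d0 * r > 0" using d0(1) r by simp
      ultimately show False using d(4) by argo
    qed
    then have "r * norm (x' - y') < e / 2" using r by (simp add: field_simps)
    then have half: "norm (r *\<^sub>R (x' - y')) < e / 2" using r by simp
    have split: "x - y = (x - r *\<^sub>R x') + (r *\<^sub>R y' - y) + r *\<^sub>R (x' - y')"
      by (simp add: algebra_simps)
    have "norm (x - y) \<le> 3 * d + 3 * d + norm (r *\<^sub>R (x' - y'))"
      unfolding split by (intro norm_triangle_mono close order_refl) (simp add: norm_minus_commute close)
    then show ?thesis using half d(3) e by linarith
  qed
  then show ?thesis using d(1) by blast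
qed

text \<open>Points \<open>x n\<close> of almost minimal norm in \<open>C n\<close> form a Cauchy
  sequence: midpoints of late terms stay in a late set, so their norms are close to the limit
  \<open>L\<close> of the minimal norms, and uniform convexity applies. This takes the place of weak
  compactness.\<close>

lemma nested_convex_inter:
  fixes C :: "nat \<Rightarrow> 'a::banach set"
  assumes uc: "uniformly_convex TYPE('a)"
    and cl: "\<And>n. closed (C n)" and cv: "\<And>n. convex (C n)"
    and anti: "\<And>m n. m \<le> n \<Longrightarrow> C n \<subseteq> C m"
    and ne: "\<And>n. \<exists>x\<in>C n. norm x \<le> M"
  shows "\<exists>x. \<forall>n. x \<in> C n"
proof -
  define m where "m n = infdist 0 (C n)" for n
  have ne': "C n \<noteq> {}" for n using ne[of n] by auto
  have "incseq m" unfolding m_def by (intro monoI infdist_mono anti ne')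
  moreover have "m n \<le> M" for n
    using ne[of n] infdist_le2[of _ "C n" 0 M] by (auto simp: m_def)
  ultimately obtain L where L: "m \<longlonglongrightarrow> L" "\<And>n. m n \<le> L"
    using incseq_convergent[of m M] by blast
  have low: "m n \<le> norm x" if "x \<in> C n" for n x
    using infdist_le[OF that, of 0] by (simp add: m_def)
  have "0 \<le> m 0" by (simp add: m_def infdist_nonneg)
  with L(2)[of 0] have L0: "0 \<le> L" by linarith
  have "\<exists>x\<in>C n. norm x < m n + inverse (real (Suc n))" for n
  proof -
    have "(INF a\<in>C n. dist 0 a) < m n + inverse (real (Suc n))"
      using ne'[of n] by (simp add: m_def infdist_def)
    moreover have "bdd_below (dist 0 ` C n)" by (intro bdd_belowI2[of _ 0]) auto
    ultimately have "\<exists>x\<in>C n. dist 0 x < m n + inverse (real (Suc n))"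
      using cINF_less_iff[OF ne'[of n]] by blast
    then show ?thesis by simp
  qed
  then obtain x where x: "\<And>n. x n \<in> C n" "\<And>n. norm (x n) < m n + inverse (real (Suc n))"
    by metis
  have "Cauchy x"
  proof (rule CauchyI)
    fix e :: real assume "e > 0"
    then obtain d where d: "d > 0" "\<And>x y :: 'a. \<lbrakk>norm x \<le> L + d; norm y \<le> L + d;
           L - d \<le> norm ((1/2) *\<^sub>R (x + y))\<rbrakk> \<Longrightarrow> norm (x - y) < e"
      using uniformly_convexD[OF uc L0] by blast
    have "\<forall>\<^sub>F n in sequentially. inverse (real (Suc n)) < d"
      using order_tendstoD(2)[OF LIMSEQ_inverse_real_of_nat d(1)] .
    moreover have "\<forall>\<^sub>F n in sequentially. L - d < m n"
      using order_tendstoD(1)[OF L(1)] d(1) by simp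
    ultimately have "\<forall>\<^sub>F n in sequentially. inverse (real (Suc n)) < d \<and> L - d < m n"
      by (rule eventually_conj)
    then obtain N where N: "\<And>n. n \<ge> N \<Longrightarrow> inverse (real (Suc n)) < d \<and> L - d < m n"
      unfolding eventually_sequentially by blast
    show "\<exists>N. \<forall>i\<ge>N. \<forall>j\<ge>N. norm (x i - x j) < e"
    proof (intro exI[of _ N] allI impI)
      fix i j assume ij: "N \<le> i" "N \<le> j"
      have "x i \<in> C N" "x j \<in> C N" using x(1) anti ij by blast+
      then have "(1/2) *\<^sub>R x i + (1/2) *\<^sub>R x j \<in> C N"
        by (intro convexD[OF cv]) auto
      then have "L - d \<le> norm ((1/2) *\<^sub>R (x i + x j))"
        using low N[of N] by (force simp: scaleR_add_right)
      moreover have "norm (x i) \<le> L + d" "norm (x j) \<le> L + d"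
        using x(2)[of i] x(2)[of j] N[OF ij(1)] N[OF ij(2)] L(2)[of i] L(2)[of j] by linarith+
      ultimately show "norm (x i - x j) < e" by (intro d(2))
    qed
  qed
  then obtain l where l: "x \<longlonglongrightarrow> l" using Cauchy_convergent convergent_def by blast
  have "l \<in> C n" for n
  proof (rule Lim_in_closed_set[OF cl _ _ l])
    show "\<forall>\<^sub>F k in sequentially. x k \<in> C n"
      using eventually_ge_at_top[of n] by eventually_elim (use x(1) anti in blast)
  qed simp
  then show ?thesis by blast
qed

section \<open>Weak sequential compactness\<close>

text \<open>The common points found here are the candidates for weak limits of subsequences of
  \<open>v\<close>.\<close>

lemma convex_tails_inter:
  fixes v :: "nat \<Rightarrow> 'a::banach"
  assumes "uniformly_convex TYPE('a)" "\<And>n. norm (v n) \<le> M"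
  shows "\<exists>x. \<forall>n. x \<in> closure (convex hull (v ` {n..}))"
proof (rule nested_convex_inter[OF assms(1)])
  show "closure (convex hull (v ` {n..})) \<subseteq> closure (convex hull (v ` {m..}))" if "m \<le> n" for m n
    using that by (intro closure_mono hull_mono) auto
  show "\<exists>x\<in>closure (convex hull (v ` {n..})). norm x \<le> M" for n
    using assms(2)[of n] by (intro bexI[of _ "v n"] subsetD[OF closure_subset] hull_inc) auto
qed (auto simp: convex_closure)

text \<open>For each \<open>e\<close> the slab \<open>H\<close> where \<open>f\<close> is within
  \<open>e\<close> of \<open>l\<close> is closed and convex and contains a tail of \<open>v\<close>,
  hence also the closed convex hull of that tail.\<close>

lemma convex_tails_functional:
  fixes f :: "'a::real_normed_vector \<Rightarrow> real"
  assumes f: "bounded_linear f" and lim: "(\<lambda>n. f (v n)) \<longlonglongrightarrow> l"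
    and x: "\<And>n. x \<in> closure (convex hull (v ` {n..}))"
  shows "f x = l"
proof -
  have "\<bar>f x - l\<bar> \<le> e" if e: "e > 0" for e
  proof -
    define H where "H = f -` {l - e..l + e}"
    obtain N where N: "\<And>n. n \<ge> N \<Longrightarrow> dist (f (v n)) l < e"
      using tendstoD[OF lim e] unfolding eventually_sequentially by blast
    have "v ` {N..} \<subseteq> H"
      using N by (fastforce simp: H_def dist_real_def)
    moreover have "convex H" unfolding H_def
      by (intro convex_linear_vimage bounded_linear.linear f) auto
    moreover have "closed H" unfolding H_def
      by (intro closed_vimage linear_continuous_on f) auto
    ultimately have "closure (convex hull (v ` {N..})) \<subseteq> H"
      by (intro closure_minimal hull_minimal)
    then show ?thesis using x[of N] by (auto simp: H_def abs_le_iff)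
  qed
  then have "\<bar>f x - l\<bar> \<le> 0" using dense_ge[of 0 "\<bar>f x - l\<bar>"] by blast
  then show ?thesis by simp
qed

text \<open>Finite rational combinations, encoded as lists of coefficient-index pairs, form a
  countable set; approximating real scalars by rationals makes its closure a subspace. Countability
  allows a diagonal argument over \<open>D\<close>.\<close>

lemma closure_rational_span:
  fixes v :: "nat \<Rightarrow> 'a::real_normed_vector"
  obtains D where "countable D" "subspace (closure D)" "range v \<subseteq> closure D"
proof -
  define g where "g xs = (\<Sum>(q, k)\<leftarrow>xs. real_of_rat q *\<^sub>R v k)" for xs :: "(rat \<times> nat) list"
  have g_add: "g xs + g ys = g (xs @ ys)" for xs ys by (simp add: g_def)
  have g_scale: "real_of_rat q *\<^sub>R g xs = g (map (\<lambda>(a, k). (q * a, k)) xs)" for q xs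
    by (induction xs) (simp_all add: g_def scaleR_add_right of_rat_mult split_beta)
  have "subspace (closure (range g))"
    unfolding subspace_def
  proof (intro conjI ballI allI)
    have "g [] = 0" by (simp add: g_def)
    then have "0 \<in> range g" by (intro range_eqI[of _ _ "[]"]) simp
    then show "0 \<in> closure (range g)" by (rule subsetD[OF closure_subset])
  next
    fix x y assume "x \<in> closure (range g)" "y \<in> closure (range g)"
    then obtain s t where st: "\<And>n. s n \<in> range g" "s \<longlonglongrightarrow> x" "\<And>n. t n \<in> range g" "t \<longlonglongrightarrow> y"
      unfolding closure_sequential by blast
    have "s n + t n \<in> range g" for n
    proof -
      obtain a b where "s n = g a" "t n = g b" using st(1)[of n] st(3)[of n] by auto
      then show ?thesis by (simp add: g_add)
    qed
    then show "x + y \<in> closure (range g)"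
      unfolding closure_sequential using tendsto_add[OF st(2,4)]
      by (intro exI[of _ "\<lambda>n. s n + t n"]) simp
  next
    fix c :: real and x assume "x \<in> closure (range g)"
    then obtain s where s: "\<And>n. s n \<in> range g" "s \<longlonglongrightarrow> x"
      unfolding closure_sequential by blast
    have "c \<in> closure \<rat>" by (simp add: Rats_closure_real)
    then obtain q where q: "\<And>n. q n \<in> \<rat>" "q \<longlonglongrightarrow> c"
      unfolding closure_sequential by blast
    have "q n *\<^sub>R s n \<in> range g" for n
    proof -
      obtain a b where "s n = g a" "q n = real_of_rat b"
        using s(1)[of n] q(1)[of n] by (auto simp: Rats_def)
      then show ?thesis by (simp add: g_scale)
    qed
    then show "c *\<^sub>R x \<in> closure (range g)"
      unfolding closure_sequential using tendsto_scaleR[OF q(2) s(2)]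
      by (intro exI[of _ "\<lambda>n. q n *\<^sub>R s n"]) simp
  qed
  moreover have "range v \<subseteq> closure (range g)"
  proof
    fix y assume "y \<in> range v"
    then obtain k where "y = v k" by blast
    then have "y = g [(1, k)]" by (simp add: g_def)
    then have "y \<in> range g" by (rule range_eqI)
    then show "y \<in> closure (range g)" by (rule subsetD[OF closure_subset])
  qed
  ultimately show ?thesis by (intro that[of "range g"]) auto
qed

text \<open>A diagonal choice makes \<open>J d\<close> converge along \<open>r\<close> for all
  \<open>d\<close> in \<open>D\<close>. These functionals leave only one candidate limit, shared by
  all further subsequences; any other functional then converges by
  \<open>subseq_criterion\<close>.\<close>

lemma weakly_convergent_subsequence:
  fixes v :: "nat \<Rightarrow> 'a::banach"
  assumes uc: "uniformly_convex TYPE('a)" and us: "uniformly_smooth TYPE('a)"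
    and M: "\<And>n. norm (v n) \<le> M"
  obtains r w where "strict_mono (r :: nat \<Rightarrow> nat)" "weakly_converges (\<lambda>n. v (r n)) w"
proof -
  obtain D where D: "countable D" "subspace (closure D)" "range v \<subseteq> closure D"
    by (rule closure_rational_span)
  obtain J :: "'a \<Rightarrow> 'a \<Rightarrow> real" where J: "\<And>x. bounded_linear (J x)" "\<And>x. J x x = norm x" "\<And>x z. \<bar>J x z\<bar> \<le> norm z"
    using support_functional[OF us] by metis
  obtain r where r: "strict_mono (r :: nat \<Rightarrow> nat)" "\<And>x. x \<in> D \<Longrightarrow> \<exists>l. (\<lambda>n. J x (v (r n))) \<longlonglongrightarrow> l"
  proof (rule function_convergent_subsequence[of D "\<lambda>n x. J x (v n)" M])
    show "norm (J x (v n)) \<le> M" for n x using J(3)[of x "v n"] M[of n] by simp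
  qed (use D in auto)
  define V where "V s n = closure (convex hull ((\<lambda>k. v (r (s k))) ` {n..}))" for s :: "nat \<Rightarrow> nat" and n
  have V_sub: "V s n \<subseteq> closure D" for s n
    unfolding V_def using D subspace_imp_convex by (intro closure_minimal hull_minimal) auto
  \<comment> \<open>All \<open>J d\<close> with \<open>d\<close> in \<open>D\<close> vanish on
    \<open>x - y\<close>. If \<open>d n\<close> in \<open>D\<close> tends to \<open>x - y\<close>,
    then \<open>norm (d n)\<close> equals \<open>J (d n) (d n - (x - y))\<close>, which tends to
    0.\<close>
  have unique: "x = y" if s: "strict_mono s" "strict_mono t" "\<And>n. x \<in> V s n" "\<And>n. y \<in> V t n" for s t x y
  proof -
    have zero: "J d (x - y) = 0" if d: "d \<in> D" for d
    proof -
      obtain l where l: "(\<lambda>n. J d (v (r n))) \<longlonglongrightarrow> l" using r(2)[OF d] by blast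
      have "J d x = l" 
        by (rule convex_tails_functional[OF J(1), where v = "\<lambda>n. v (r (s n))"])
          (use s LIMSEQ_subseq_LIMSEQ[OF l s(1)] in \<open>auto simp: V_def o_def\<close>)
      moreover have "J d y = l" 
        by (rule convex_tails_functional[OF J(1), where v = "\<lambda>n. v (r (t n))"])
          (use s LIMSEQ_subseq_LIMSEQ[OF l s(2)] in \<open>auto simp: V_def o_def\<close>)
      ultimately show ?thesis
        using linear_diff[OF bounded_linear.linear[OF J(1)], of d x y] by simp
    qed
    have "x - y \<in> closure D"
      using V_sub s(3)[of 0] s(4)[of 0] by (intro subspace_diff D(2)) auto
    then obtain d where d: "\<And>n. d n \<in> D" "d \<longlonglongrightarrow> x - y"
      unfolding closure_sequential by blast
    have le: "norm (d n) \<le> norm (d n - (x - y))" for n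
    proof -
      have "J (d n) (d n - (x - y)) = J (d n) (d n) - J (d n) (x - y)"
        by (rule linear_diff[OF bounded_linear.linear[OF J(1)]])
      also have "\<dots> = norm (d n)" using J(2) zero[OF d(1)] by simp
      finally show ?thesis using J(3)[of "d n" "d n - (x - y)"] by linarith
    qed
    have "(\<lambda>n. norm (d n - (x - y))) \<longlonglongrightarrow> 0"
      by (rule tendsto_norm_zero[OF LIM_zero[OF d(2)]])
    then have "d \<longlonglongrightarrow> 0"
      by (rule Lim_null_comparison[rotated]) (use le in simp)
    then have "x - y = 0" using LIMSEQ_unique[OF d(2)] by blast
    then show ?thesis by simp
  qed
  have ex: "\<exists>x. \<forall>n. x \<in> V s n" for s
    unfolding V_def by (rule convex_tails_inter[OF uc, of _ M]) (rule M)
  obtain w where w: "\<And>n. w \<in> V id n" using ex by blast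
  have "weakly_converges (\<lambda>n. v (r n)) w"
    unfolding weakly_converges_def
  proof (intro allI impI subseq_criterion)
    fix f :: "'a \<Rightarrow> real" and s :: "nat \<Rightarrow> nat"
    assume f: "bounded_linear f" and s: "strict_mono s"
    have "bounded (range (\<lambda>n. f (v (r (s n)))))"
    proof -
      have "bounded (range (\<lambda>n. v (r (s n))))" using M by (auto simp: bounded_iff)
      from bounded_linear_image[OF this f] show ?thesis by (simp add: image_image)
    qed
    then obtain l t where t: "strict_mono (t :: nat \<Rightarrow> nat)" "(\<lambda>n. f (v (r (s (t n))))) \<longlonglongrightarrow> l"
      using bounded_imp_convergent_subsequence[of "\<lambda>n. f (v (r (s n)))"] by (auto simp: o_def)
    \<comment> \<open>The candidate for the thinned sequence must be \<open>w\<close> by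
      \<open>unique\<close>, while \<open>f\<close> takes the value \<open>l\<close> at it; so
      \<open>l = f w\<close>.\<close>
    obtain x where x: "\<And>n. x \<in> V (s \<circ> t) n" using ex by blast
    have "x = w"
      by (rule unique[of "s \<circ> t" id]) (use x w s t in \<open>auto intro: strict_mono_o strict_mono_id\<close>)
    moreover have "f x = l"
      by (rule convex_tails_functional[OF f t(2)]) (use x in \<open>auto simp: V_def\<close>)
    ultimately show "\<exists>t. strict_mono t \<and> (\<lambda>n. f (v (r (s (t n))))) \<longlonglongrightarrow> f w"
      using t by auto
  qed
  with r(1) show ?thesis using that by blast
qed

section \<open>Weak limits and the Kadec-Klee property\<close>

lemma weakly_converges_subseq:
  assumes "weakly_converges v w" "strict_mono r"
  shows "weakly_converges (\<lambda>n. v (r n)) w"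
  unfolding weakly_converges_def
proof (intro allI impI)
  fix f :: "'a \<Rightarrow> real" assume "bounded_linear f"
  then have "(\<lambda>n. f (v n)) \<longlonglongrightarrow> f w" using assms(1) by (simp add: weakly_converges_def)
  from LIMSEQ_subseq_LIMSEQ[OF this assms(2)] show "(\<lambda>n. f (v (r n))) \<longlonglongrightarrow> f w"
    by (simp add: o_def)
qed

lemma weakly_converges_diff_const:
  assumes "weakly_converges v w"
  shows "weakly_converges (\<lambda>n. a - v n) (a - w)"
  unfolding weakly_converges_def
proof (intro allI impI)
  fix f :: "'a \<Rightarrow> real" assume f: "bounded_linear f"
  then have "(\<lambda>n. f (v n)) \<longlonglongrightarrow> f w" using assms by (simp add: weakly_converges_def)
  from tendsto_diff[OF tendsto_const this, of "f a"]
  show "(\<lambda>n. f (a - v n)) \<longlonglongrightarrow> f (a - w)"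
    by (simp add: linear_diff[OF bounded_linear.linear[OF f]])
qed

text \<open>Testing with a norming functional of \<open>w\<close> gives weak lower semicontinuity of
  the norm.\<close>

lemma norm_weak_limit_le:
  fixes v :: "nat \<Rightarrow> 'a::real_normed_vector"
  assumes "uniformly_smooth TYPE('a)" "weakly_converges v w" "(\<lambda>n. norm (v n)) \<longlonglongrightarrow> c"
  shows "norm w \<le> c"
proof -
  obtain f where f: "bounded_linear f" "f w = norm w" "\<And>z. \<bar>f z\<bar> \<le> norm z"
    using support_functional[OF assms(1)] by metis
  have fv: "(\<lambda>n. f (v n)) \<longlonglongrightarrow> norm w"
    using assms(2) f(1) unfolding weakly_converges_def by (simp flip: f(2))
  have "f (v n) \<le> norm (v n)" for n using f(3)[of "v n"] by linarith
  then show ?thesis by (intro LIMSEQ_le[OF fv assms(3)] exI[of _ 0]) simp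
qed

text \<open>A norming functional of \<open>w\<close> shows that the midpoint of \<open>v n\<close>
  and \<open>w\<close> has norm almost \<open>norm w\<close>; uniform convexity then brings
  \<open>v n\<close> close to \<open>w\<close>.\<close>

lemma kadec_klee:
  fixes v :: "nat \<Rightarrow> 'a::real_normed_vector"
  assumes uc: "uniformly_convex TYPE('a)" and us: "uniformly_smooth TYPE('a)"
    and w: "weakly_converges v w" and nv: "(\<lambda>n. norm (v n)) \<longlonglongrightarrow> norm w"
  shows "v \<longlonglongrightarrow> w"
proof (rule LIMSEQ_I)
  fix e :: real assume "e > 0"
  then obtain d where d: "d > 0" "\<And>x y :: 'a. \<lbrakk>norm x \<le> norm w + d; norm y \<le> norm w + d;
         norm w - d \<le> norm ((1/2) *\<^sub>R (x + y))\<rbrakk> \<Longrightarrow> norm (x - y) < e"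
    using uniformly_convexD[OF uc norm_ge_zero[of w]] by blast
  obtain f where f: "bounded_linear f" "f w = norm w" "\<And>z. \<bar>f z\<bar> \<le> norm z"
    using support_functional[OF us] by metis
  have fv: "(\<lambda>n. f (v n)) \<longlonglongrightarrow> norm w"
    using w f(1) unfolding weakly_converges_def by (simp flip: f(2))
  have "\<forall>\<^sub>F n in sequentially. norm w - d < f (v n)"
    using order_tendstoD(1)[OF fv] d(1) by simp
  moreover have "\<forall>\<^sub>F n in sequentially. norm (v n) < norm w + d"
    using order_tendstoD(2)[OF nv] d(1) by simp
  ultimately have "\<forall>\<^sub>F n in sequentially. norm (v n - w) < e"
  proof eventually_elim
    case (elim n)
    have "f ((1/2) *\<^sub>R (v n + w)) = (f (v n) + norm w) / 2"
      using f(1,2) by (simp add: linear_add linear_scale bounded_linear.linear)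
    then have mid: "norm w - d \<le> norm ((1/2) *\<^sub>R (v n + w))"
      using abs_le_D1[OF f(3)[of "(1/2) *\<^sub>R (v n + w)"]] elim d(1) by argo
    show ?case by (rule d(2)[OF _ _ mid]) (use elim d(1) in linarith)+
  qed
  then show "\<exists>N. \<forall>n\<ge>N. norm (v n - w) < e" unfolding eventually_sequentially .
qed

subsection \<open>Chebyshev sets for an equivalent norm\<close>

text \<open>The product type already carries the Euclidean combination of its two norms, so the norm
  relevant for the minimization is a separate function \<open>N\<close>; the constant
  \<open>b\<close> transfers convergence and completeness.\<close>

locale equivalent_norm =
  fixes N :: "'x::banach \<Rightarrow> real" and b :: real
  assumes N_triangle: "N (x + y) \<le> N x + N y"
    and N_scale: "N (c *\<^sub>R x) = \<bar>c\<bar> * N x"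
    and norm_le_N: "norm x \<le> b * N x"
    and N_le_norm: "N x \<le> b * norm x"
    and b_pos: "0 < b"
begin

lemma N_nonneg: "0 \<le> N x"
  using order_trans[OF norm_ge_zero norm_le_N] b_pos by (simp add: zero_le_mult_iff)

lemma N_eq_0: "N x = 0 \<longleftrightarrow> x = 0"
  using norm_le_N[of x] N_scale[of 0 x] by auto

lemma N_0: "N 0 = 0"
  by (simp add: N_eq_0)

lemma N_pos: "x \<noteq> 0 \<Longrightarrow> 0 < N x"
  using N_nonneg[of x] N_eq_0[of x] by simp

lemma N_minus: "N (- x) = N x"
  using N_scale[of "- 1" x] by simp

lemma N_commute: "N (x - y) = N (y - x)"
  using N_minus[of "x - y"] by simp

lemma N_triangle_diff: "N (x - z) \<le> N (x - y) + N (y - z)"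
  using N_triangle[of "x - y" "y - z"] by simp

lemma N_tendsto_0: "X \<longlonglongrightarrow> l \<Longrightarrow> (\<lambda>n. N (X n - l)) \<longlonglongrightarrow> 0"
  by (rule Lim_null_comparison[of _ "\<lambda>n. b * norm (X n - l)"])
    (auto simp: N_nonneg N_le_norm intro!: tendsto_mult_right_zero tendsto_norm_zero LIM_zero)

lemma N_tendsto:
  assumes "X \<longlonglongrightarrow> l"
  shows "(\<lambda>n. N (X n)) \<longlonglongrightarrow> N l"
proof (rule LIM_zero_cancel, rule Lim_null_comparison[OF _ N_tendsto_0[OF assms]])
  show "\<forall>\<^sub>F n in sequentially. norm (N (X n) - N l) \<le> N (X n - l)"
    using N_triangle[of "X n - l" l for n] N_triangle[of "l - X n" "X n" for n] N_commute[of l]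
    by (auto simp: abs_le_iff algebra_simps)
qed

section \<open>Distance function and nearest points\<close>

definition N_dist :: "'x set \<Rightarrow> 'x \<Rightarrow> real" where
  "N_dist G x = (INF g\<in>G. N (x - g))"

lemma N_dist_le: "g \<in> G \<Longrightarrow> N_dist G x \<le> N (x - g)"
  unfolding N_dist_def by (rule cINF_lower) (auto intro!: bdd_belowI2[of _ 0] N_nonneg)

lemma N_dist_ge: "G \<noteq> {} \<Longrightarrow> (\<And>g. g \<in> G \<Longrightarrow> c \<le> N (x - g)) \<Longrightarrow> c \<le> N_dist G x"
  unfolding N_dist_def by (rule cINF_greatest)

lemma N_dist_lipschitz:
  assumes "G \<noteq> {}"
  shows "N_dist G x \<le> N_dist G y + N (x - y)"
proof -
  have "N_dist G x - N (x - y) \<le> N_dist G y"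
  proof (rule N_dist_ge[OF assms])
    fix g assume "g \<in> G"
    then show "N_dist G x - N (x - y) \<le> N (y - g)"
      using N_dist_le[of g G x] N_triangle_diff[of x g y] by linarith
  qed
  then show ?thesis by simp
qed

lemma N_dist_tendsto:
  assumes "G \<noteq> {}" "X \<longlonglongrightarrow> l"
  shows "(\<lambda>n. N_dist G (X n)) \<longlonglongrightarrow> N_dist G l"
proof (rule LIM_zero_cancel, rule Lim_null_comparison[OF _ N_tendsto_0[OF assms(2)]])
  have "norm (N_dist G (X n) - N_dist G l) \<le> N (X n - l)" for n
    using N_dist_lipschitz[OF assms(1), of "X n" l] N_dist_lipschitz[OF assms(1), of l "X n"]
      N_commute[of l "X n"] by (simp add: abs_le_iff)
  then show "\<forall>\<^sub>F n in sequentially. norm (N_dist G (X n) - N_dist G l) \<le> N (X n - l)" by simp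
qed

text \<open>Known as approximative compactness; it yields existence of nearest points and, where
  they are unique, their continuity.\<close>

definition approx_compact :: "'x set \<Rightarrow> bool" where
  "approx_compact G \<longleftrightarrow> (\<forall>x g. (\<forall>n::nat. g n \<in> G) \<longrightarrow> (\<lambda>n. N (x - g n)) \<longlonglongrightarrow> N_dist G x \<longrightarrow>
     (\<exists>l\<in>G. \<exists>r. strict_mono r \<and> (\<lambda>n. g (r n)) \<longlonglongrightarrow> l))"

lemma nearest_exists:
  assumes G: "G \<noteq> {}" "approx_compact G"
  obtains g where "g \<in> G" "N (x - g) = N_dist G x"
proof -
  have "\<exists>g\<in>G. N (x - g) < N_dist G x + inverse (real (Suc n))" for n
  proof (rule ccontr)
    assume "\<not> ?thesis"
    then have "N_dist G x + inverse (real (Suc n)) \<le> N_dist G x"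
      by (intro N_dist_ge G) (auto simp: not_less)
    then show False by simp
  qed
  then obtain g where g: "\<And>n. g n \<in> G" "\<And>n. N (x - g n) < N_dist G x + inverse (real (Suc n))"
    by metis
  have lim: "(\<lambda>n. N (x - g n)) \<longlonglongrightarrow> N_dist G x"
  proof (rule tendsto_sandwich[OF _ _ tendsto_const])
    show "(\<lambda>n. N_dist G x + inverse (real (Suc n))) \<longlonglongrightarrow> N_dist G x"
      using tendsto_add[OF tendsto_const[of "N_dist G x"] LIMSEQ_inverse_real_of_nat] by simp
    show "\<forall>\<^sub>F n in sequentially. N (x - g n) \<le> N_dist G x + inverse (real (Suc n))"
      by (intro always_eventually allI less_imp_le g(2))
    show "\<forall>\<^sub>F n in sequentially. N_dist G x \<le> N (x - g n)"
      by (intro always_eventually allI N_dist_le g(1))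
  qed
  then obtain l r where l: "l \<in> G" "strict_mono (r :: nat \<Rightarrow> nat)" "(\<lambda>n. g (r n)) \<longlonglongrightarrow> l"
    using G(2)[unfolded approx_compact_def, rule_format, OF g(1) lim] by blast
  have "(\<lambda>n. N (x - g (r n))) \<longlonglongrightarrow> N (x - l)"
    by (intro N_tendsto tendsto_intros l)
  moreover have "(\<lambda>n. N (x - g (r n))) \<longlonglongrightarrow> N_dist G x"
    using LIMSEQ_subseq_LIMSEQ[OF lim l(2)] by (simp add: o_def)
  ultimately have "N (x - l) = N_dist G x" by (rule LIMSEQ_unique)
  with l(1) show ?thesis by (rule that)
qed

text \<open>By the Lipschitz property of the distance, nearest points of \<open>X n\<close> form a
  minimizing sequence for \<open>x\<close>. Approximative compactness supplies limits of
  subsequences, and each is nearest to \<open>x\<close>, hence \<open>l\<close>.\<close>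

lemma nearest_tendsto:
  assumes G: "G \<noteq> {}" "approx_compact G"
    and X: "X \<longlonglongrightarrow> x"
    and g: "\<And>n. g n \<in> G" "\<And>n. N (X n - g n) = N_dist G (X n)"
    and uniq: "\<And>a. a \<in> G \<Longrightarrow> N (x - a) = N_dist G x \<Longrightarrow> a = l"
  shows "g \<longlonglongrightarrow> l"
proof (rule subseq_criterion)
  fix s :: "nat \<Rightarrow> nat" assume s: "strict_mono s"
  have lim: "(\<lambda>n. N (x - g n)) \<longlonglongrightarrow> N_dist G x"
  proof (rule tendsto_sandwich[OF _ _ tendsto_const])
    show "(\<lambda>n. N_dist G (X n) + N (X n - x)) \<longlonglongrightarrow> N_dist G x"
      using tendsto_add[OF N_dist_tendsto[OF G(1) X] N_tendsto_0[OF X]] by simp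
    have "N (x - g n) \<le> N_dist G (X n) + N (X n - x)" for n
      using N_triangle_diff[of x "g n" "X n"] N_commute[of x "X n"] g(2)[of n] by simp
    then show "\<forall>\<^sub>F n in sequentially. N (x - g n) \<le> N_dist G (X n) + N (X n - x)" by simp
  qed (use g N_dist_le in auto)
  have sub: "(\<lambda>n. N (x - g (s n))) \<longlonglongrightarrow> N_dist G x"
    using LIMSEQ_subseq_LIMSEQ[OF lim s] by (simp add: o_def)
  then obtain a r where a: "a \<in> G" "strict_mono (r :: nat \<Rightarrow> nat)" "(\<lambda>n. g (s (r n))) \<longlonglongrightarrow> a"
    using G(2)[unfolded approx_compact_def, rule_format, OF g(1) sub] by blast
  have "(\<lambda>n. N (x - g (s (r n)))) \<longlonglongrightarrow> N (x - a)"
    by (intro N_tendsto tendsto_intros a)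
  moreover have "(\<lambda>n. N (x - g (s (r n)))) \<longlonglongrightarrow> N_dist G x"
    using LIMSEQ_subseq_LIMSEQ[OF sub a(2)] by (simp add: o_def)
  ultimately have "N (x - a) = N_dist G x" by (rule LIMSEQ_unique)
  then have "a = l" using uniq a(1) by blast
  then show "\<exists>r. strict_mono r \<and> (\<lambda>n. g (s (r n))) \<longlonglongrightarrow> l" using a by blast
qed

section \<open>Vlasov's theorem\<close>

text \<open>Existence is left to \<open>nearest_exists\<close>; the two together make
  \<open>G\<close> a Chebyshev set.\<close>

definition unique_nearest :: "'x set \<Rightarrow> bool" where
  "unique_nearest G \<longleftrightarrow> (\<forall>x. \<forall>a\<in>G. \<forall>b\<in>G. N (x - a) = N_dist G x \<longrightarrow> N (x - b) = N_dist G x \<longrightarrow> a = b)"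

text \<open>Moving \<open>x\<close> slightly away from its nearest point \<open>a\<close> moves the
  nearest point only slightly, by continuity; hence the distance grows almost as fast as
  \<open>x\<close> moves.\<close>

lemma N_dist_slope:
  assumes G: "G \<noteq> {}" "approx_compact G"
    and uniq: "unique_nearest G"
    and x: "0 < N_dist G x" and \<sigma>: "\<sigma> < 1" and \<tau>: "0 < \<tau>"
  obtains z where "z \<noteq> x" "N (z - x) \<le> \<tau>" "N_dist G x + \<sigma> * N (z - x) \<le> N_dist G z"
proof -
  define d where "d = N_dist G x"
  obtain a where a: "a \<in> G" "N (x - a) = d"
    using nearest_exists[OF G, of x] unfolding d_def by metis
  define e where "e = (x - a) /\<^sub>R d"
  have d: "0 < d" and e: "N e = 1" using x a by (auto simp: d_def e_def N_scale)
  define X where "X n = x + inverse (real (Suc n)) *\<^sub>R e" for n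
  have "\<exists>g. g \<in> G \<and> N (X n - g) = N_dist G (X n)" for n
    using nearest_exists[OF G, of "X n"] by metis
  then obtain g where g: "\<And>n. g n \<in> G" "\<And>n. N (X n - g n) = N_dist G (X n)"
    by metis
  have "X \<longlonglongrightarrow> x + 0 *\<^sub>R e"
    unfolding X_def by (intro tendsto_intros LIMSEQ_inverse_real_of_nat)
  then have X: "X \<longlonglongrightarrow> x" by simp
  have "g \<longlonglongrightarrow> a"
  proof (rule nearest_tendsto[OF G X g])
    fix c assume "c \<in> G" "N (x - c) = N_dist G x"
    then show "c = a" using uniq a unfolding unique_nearest_def d_def by blast
  qed
  \<comment> \<open>With this threshold the error term of a step of length \<open>t\<close> costs at
    most \<open>t * ((1 - \<sigma>) * d)\<close>, so that a gain of \<open>\<sigma> * t\<close>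
    survives the division by \<open>d\<close>.\<close>
  then have "\<forall>\<^sub>F n in sequentially. N (g n - a) < (1 - \<sigma>) * d"
    using order_tendstoD(2)[OF N_tendsto_0] \<sigma> d by auto
  moreover have "\<forall>\<^sub>F n in sequentially. inverse (real (Suc n)) < \<tau>"
    using order_tendstoD(2)[OF LIMSEQ_inverse_real_of_nat \<tau>] .
  ultimately have "\<forall>\<^sub>F n in sequentially. N (g n - a) < (1 - \<sigma>) * d \<and> inverse (real (Suc n)) < \<tau>"
    by (rule eventually_conj)
  then obtain n where n: "N (g n - a) < (1 - \<sigma>) * d" "inverse (real (Suc n)) < \<tau>"
    unfolding eventually_sequentially by blast
  define t where "t = inverse (real (Suc n))"
  have t: "0 < t" by (simp add: t_def)
  have Xn: "X n = x + t *\<^sub>R e" by (simp add: X_def t_def)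
  have Nt: "N (X n - x) = t" using t e by (simp add: Xn N_scale)
  \<comment> \<open>\<open>x - g n\<close> lies on the segment from \<open>a - g n\<close> to \<open>X n - g n\<close>, and \<open>a - g n\<close> is short.\<close>
  have "x - a = d *\<^sub>R e" using d by (simp add: e_def)
  then have "(t + d) *\<^sub>R (x - g n) = d *\<^sub>R (X n - g n) + t *\<^sub>R (a - g n)"
    by (simp add: Xn algebra_simps)
  then have "(t + d) * N (x - g n) \<le> N (d *\<^sub>R (X n - g n)) + N (t *\<^sub>R (a - g n))"
    using N_scale[of "t + d" "x - g n"] N_triangle[of "d *\<^sub>R (X n - g n)" "t *\<^sub>R (a - g n)"] t d by simp
  then have "(t + d) * N (x - g n) \<le> d * N_dist G (X n) + t * N (a - g n)"
    using t d g(2) by (simp add: N_scale)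
  moreover have "(t + d) * d \<le> (t + d) * N (x - g n)"
    using t d N_dist_le[OF g(1)[of n], of x] by (intro mult_left_mono) (auto simp: d_def)
  moreover have "t * N (a - g n) \<le> t * ((1 - \<sigma>) * d)"
    using n(1) N_commute[of a "g n"] t by (intro mult_left_mono) auto
  ultimately have "d * (d + \<sigma> * t) \<le> d * N_dist G (X n)"
    by (simp add: algebra_simps)
  then have "d + \<sigma> * t \<le> N_dist G (X n)" using d by simp
  moreover have "X n \<noteq> x" using Nt t N_0 by auto
  ultimately show ?thesis
    using that[of "X n"] Nt n(2) by (simp add: d_def t_def)
qed

text \<open>An Ekeland-type argument for the relation \<open>w \<in> A z\<close>: greedy, almost
  maximal choices converge to a point \<open>l\<close> with no proper successor, and
  \<open>N_dist_slope\<close> forces such a point onto the sphere of radius \<open>R\<close> around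
  \<open>x0\<close>.\<close>

lemma N_dist_grow:
  assumes G: "G \<noteq> {}" "approx_compact G"
    and uniq: "unique_nearest G"
    and x0: "0 < N_dist G x0" and \<sigma>: "0 < \<sigma>" "\<sigma> < 1" and R: "0 < R"
  obtains z where "N (z - x0) = R" "N_dist G x0 + \<sigma> * R \<le> N_dist G z"
proof -
  define A where "A z = {w. N (w - x0) \<le> R \<and> N_dist G z + \<sigma> * N (w - z) \<le> N_dist G w}" for z
  have A_trans: "u \<in> A z" if "w \<in> A z" "u \<in> A w" for u w z
  proof -
    have "\<sigma> * N (u - z) \<le> \<sigma> * (N (u - w) + N (w - z))"
      using \<sigma> N_triangle_diff by (intro mult_left_mono) auto
    then show ?thesis using that by (simp add: A_def algebra_simps)
  qed
  have bound: "N_dist G w \<le> N_dist G x0 + R" if "w \<in> A z" for w z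
    using N_dist_lipschitz[OF G(1), of w x0] that by (simp add: A_def)
  have step: "\<exists>w\<in>A z. \<forall>u\<in>A z. N_dist G u < N_dist G w + (1/2) ^ n"
    if z: "N (z - x0) \<le> R" for z and n :: nat
  proof -
    have zA: "z \<in> A z" using z by (simp add: A_def N_0)
    have bdd: "bdd_above (N_dist G ` A z)" using bound by (intro bdd_aboveI2)
    have "Sup (N_dist G ` A z) - (1/2) ^ n < Sup (N_dist G ` A z)" by simp
    then obtain w where w: "w \<in> A z" "Sup (N_dist G ` A z) - (1/2) ^ n < N_dist G w"
      using zA bdd by (subst (asm) less_cSUP_iff) auto
    have "N_dist G u < N_dist G w + (1/2) ^ n" if "u \<in> A z" for u
      using cSUP_upper[OF that bdd] w(2) by linarith
    then show ?thesis using w(1) by blast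
  qed
  have "\<exists>z. z 0 = x0 \<and> (\<forall>n. N (z n - x0) \<le> R \<and> z (Suc n) \<in> A (z n) \<and>
      (\<forall>u\<in>A (z n). N_dist G u < N_dist G (z (Suc n)) + (1/2) ^ n))"
  proof -
    \<comment> \<open>The choice at stage \<open>n\<close> misses the supremum of the distance over
      \<open>A z\<close> by less than \<open>(1/2) ^ n\<close>.\<close>
    define f where "f n z = (SOME w. w \<in> A z \<and> (\<forall>u\<in>A z. N_dist G u < N_dist G w + (1/2) ^ n))" for n :: nat and z
    have f: "f n z \<in> A z" "\<forall>u\<in>A z. N_dist G u < N_dist G (f n z) + (1/2) ^ n" if "N (z - x0) \<le> R" for n z
      using someI_ex[OF step[OF that, of n, unfolded Bex_def]] unfolding f_def by blast+
    define z where "z = rec_nat x0 f"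
    have z_simps: "z 0 = x0" "z (Suc n) = f n (z n)" for n by (auto simp: z_def)
    have zR: "N (z n - x0) \<le> R" for n
    proof (induction n)
      case 0
      show ?case using R by (simp add: z_simps N_0)
    next
      case (Suc n)
      show ?case using f(1)[OF Suc, of n] by (simp add: z_simps A_def)
    qed
    show ?thesis
      by (intro exI[of _ z] conjI allI z_simps zR) (simp_all add: z_simps f zR)
  qed
  then obtain z where z: "z 0 = x0" "\<And>n. N (z n - x0) \<le> R" "\<And>n. z (Suc n) \<in> A (z n)"
      "\<And>n u. u \<in> A (z n) \<Longrightarrow> N_dist G u < N_dist G (z (Suc n)) + (1/2) ^ n"
    by blast
  have zA: "z (n + k) \<in> A (z n)" for n k
  proof (induction k)
    case 0
    show ?case using z(2) by (simp add: A_def N_0)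
  next
    case (Suc k)
    then show ?case using A_trans[OF Suc z(3)] by simp
  qed
  \<comment> \<open>A successor gains at least \<sigma> times its displacement, but the near-maximal
    choice leaves a gain of less than \<open>(1/2) ^ n\<close>.\<close>
  have close: "N (u - z (Suc n)) \<le> (1/2) ^ n / \<sigma>" if "u \<in> A (z (Suc n))" for u n
  proof -
    have "u \<in> A (z n)" using A_trans[OF z(3) that] .
    then have "\<sigma> * N (u - z (Suc n)) \<le> (1/2) ^ n"
      using z(4)[of u n] that by (simp add: A_def)
    then show ?thesis using \<sigma> by (simp add: field_simps)
  qed
  have small: "(\<lambda>n. (1/2) ^ n / \<sigma>) \<longlonglongrightarrow> 0"
    by (intro tendsto_divide_zero LIMSEQ_power_zero) simp
  have "Cauchy (\<lambda>n. z (Suc n))"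
  proof (rule CauchyI')
    fix e :: real assume "e > 0"
    then have "e / b > 0" using b_pos by simp
    then obtain M where M: "\<And>n. n \<ge> M \<Longrightarrow> (1/2) ^ n / \<sigma> < e / b"
      using order_tendstoD(2)[OF small] unfolding eventually_sequentially by blast
    show "\<exists>M. \<forall>m\<ge>M. \<forall>n>m. dist (z (Suc m)) (z (Suc n)) < e"
    proof (intro exI[of _ M] allI impI)
      fix m n assume mn: "M \<le> m" "m < n"
      then have "z (Suc n) \<in> A (z (Suc m))" using zA[of "Suc m" "n - m"] by simp
      from close[OF this] have "N (z (Suc n) - z (Suc m)) < e / b" using M[OF mn(1)] by linarith
      then have "b * N (z (Suc n) - z (Suc m)) < e" using b_pos by (simp add: field_simps)
      then show "dist (z (Suc m)) (z (Suc n)) < e"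
        using norm_le_N[of "z (Suc n) - z (Suc m)"] by (simp add: dist_norm norm_minus_commute)
    qed
  qed
  then obtain l where "(\<lambda>n. z (Suc n)) \<longlonglongrightarrow> l" using Cauchy_convergent convergent_def by blast
  then have l: "z \<longlonglongrightarrow> l" by (rule LIMSEQ_imp_Suc)
  have lA: "l \<in> A (z n)" for n
  proof -
    have lk: "(\<lambda>k. z (n + k)) \<longlonglongrightarrow> l" using LIMSEQ_ignore_initial_segment[OF l, of n] by (simp add: add.commute)
    have "N (l - x0) \<le> R"
      by (rule LIMSEQ_le_const2[OF N_tendsto[OF tendsto_diff[OF l tendsto_const]]]) (use z(2) in blast)
    moreover have "N_dist G (z n) + \<sigma> * N (l - z n) \<le> N_dist G l"
    proof (rule LIMSEQ_le)
      show "(\<lambda>k. N_dist G (z n) + \<sigma> * N (z (n + k) - z n)) \<longlonglongrightarrow> N_dist G (z n) + \<sigma> * N (l - z n)"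
        by (intro tendsto_intros N_tendsto lk)
      show "(\<lambda>k. N_dist G (z (n + k))) \<longlonglongrightarrow> N_dist G l" by (rule N_dist_tendsto[OF G(1) lk])
    qed (use zA[of n] in \<open>auto simp: A_def\<close>)
    ultimately show ?thesis by (simp add: A_def)
  qed
  have fixed: "u = l" if "u \<in> A l" for u
  proof -
    have "u \<in> A (z (Suc n))" for n using A_trans[OF lA that] .
    then have le: "N (u - z (Suc n)) \<le> (1/2) ^ n / \<sigma>" for n by (rule close)
    have "(\<lambda>n. N (u - z (Suc n))) \<longlonglongrightarrow> N (u - l)"
      by (intro N_tendsto tendsto_intros LIMSEQ_Suc l)
    then have "N (u - l) \<le> 0" by (rule LIMSEQ_le[OF _ small]) (use le in blast)
    then show ?thesis using N_nonneg[of "u - l"] N_eq_0[of "u - l"] by auto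
  qed
  have l0: "N (l - x0) \<le> R" "N_dist G x0 + \<sigma> * N (l - x0) \<le> N_dist G l"
    using lA[of 0] z(1) by (auto simp: A_def)
  have "N (l - x0) = R"
  proof (rule ccontr)
    \<comment> \<open>Strictly inside the ball there is room for a further step of length at most
      \<open>R - N (l - x0)\<close>, which would be a proper successor of \<open>l\<close>.\<close>
    assume "N (l - x0) \<noteq> R"
    then have "0 < R - N (l - x0)" using l0 by simp
    moreover have "0 \<le> \<sigma> * N (l - x0)" using \<sigma> N_nonneg by simp
    then have "0 < N_dist G l" using x0 l0(2) by linarith
    ultimately obtain w where w: "w \<noteq> l" "N (w - l) \<le> R - N (l - x0)" "N_dist G l + \<sigma> * N (w - l) \<le> N_dist G w"
      using N_dist_slope[OF G uniq _ \<sigma>(2)] by metis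
    have "N (w - x0) \<le> R" using N_triangle_diff[of w x0 l] w(2) by linarith
    then have "w \<in> A l" using w(3) by (simp add: A_def)
    then show False using fixed w(1) by blast
  qed
  then show ?thesis using that[of l] l0(2) by simp
qed

text \<open>If \<open>x0\<close> lies between \<open>a\<close> and \<open>c\<close> but outside
  \<open>G\<close>, some \<open>z\<close> at large distance \<open>R\<close> from \<open>x0\<close>
  is at distance at least \<open>R + r / 2\<close> from both. On the scale of \<open>R\<close> the
  sphere around \<open>z\<close> is almost flat at \<open>x0\<close>, so \<open>a\<close> and
  \<open>c\<close> cannot both be that far outside it.\<close>

lemma chebyshev_convex:
  assumes smooth: "\<And>e. 0 < e \<Longrightarrow> \<exists>\<delta>>0. \<forall>x y. N x = 1 \<longrightarrow> N y \<le> \<delta> \<longrightarrow> N (x + y) + N (x - y) \<le> 2 + e * N y"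
    and G: "G \<noteq> {}" "approx_compact G"
    and uniq: "unique_nearest G"
  shows "convex G"
proof (rule ccontr)
  assume "\<not> convex G"
  then obtain a c s where ac: "a \<in> G" "c \<in> G" "0 \<le> s" "s \<le> 1" and out: "(1 - s) *\<^sub>R a + s *\<^sub>R c \<notin> G"
    unfolding convex_alt by blast
  define x0 where "x0 = (1 - s) *\<^sub>R a + s *\<^sub>R c"
  define h where "h = c - a"
  have s: "0 < s" "s < 1" using ac out by (auto simp: less_le)
  have h: "N h > 0" 
  proof (rule N_pos)
    show "h \<noteq> 0" using out ac by (auto simp: h_def algebra_simps)
  qed
  define r where "r = N_dist G x0"
  have r: "r > 0"
  proof -
    obtain g where g: "g \<in> G" "N (x0 - g) = r" using nearest_exists[OF G] r_def by metis
    then have "x0 \<noteq> g" using out x0_def by blast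
    then show ?thesis using N_pos[of "x0 - g"] g(2) by simp
  qed
  \<comment> \<open>Smoothness will allow a total excess \<open>e * N h = r / 2\<close>, while the
    two lower bounds give a total excess \<open>r\<close>.\<close>
  define e where "e = r / (2 * N h)"
  have e: "e > 0" "e * N h = r / 2" using r h by (auto simp: e_def)
  obtain \<delta> where \<delta>: "\<delta> > 0" "\<And>x y. N x = 1 \<Longrightarrow> N y \<le> \<delta> \<Longrightarrow> N (x + y) + N (x - y) \<le> 2 + e * N y"
    using smooth[OF e(1)] by blast
  \<comment> \<open>The first bound makes \<open>h /\<^sub>R R\<close> short enough for smoothness,
    the second makes \<sigma> positive. The choice of \<sigma> loses only \<open>r / 2\<close> over
    the distance \<open>R\<close>.\<close>
  define R where "R = max (N h / \<delta>) r"
  have R: "R > 0" "N h / \<delta> \<le> R" "r \<le> R" using r by (auto simp: R_def)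
  define \<sigma> where "\<sigma> = 1 - r / (2 * R)"
  have \<sigma>: "0 < \<sigma>" "\<sigma> < 1" "\<sigma> * R = R - r / 2" using R r by (auto simp: \<sigma>_def field_simps)
  obtain z where z: "N (z - x0) = R" "r + \<sigma> * R \<le> N_dist G z"
    using N_dist_grow[OF G uniq _ \<sigma>(1,2) R(1), of x0] r r_def by metis
  define w where "w = z - x0"
  have w: "N w = R" using z(1) by (simp add: w_def)
  have za: "z - a = w + s *\<^sub>R h" and zc: "z - c = w - (1 - s) *\<^sub>R h"
    by (auto simp: w_def x0_def h_def algebra_simps)
  have far: "R + r / 2 \<le> N (w + s *\<^sub>R h)" "R + r / 2 \<le> N (w - (1 - s) *\<^sub>R h)"
    using N_dist_le[OF ac(1), of z] N_dist_le[OF ac(2), of z] z(2) \<sigma>(3) unfolding za zc by linarith+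
  \<comment> \<open>Convexity of \<open>N\<close> along the line \<open>w + t h\<close> moves the lower bounds to \<open>t = 1\<close> and \<open>t = -1\<close>.\<close>
  have extend: "R + r / 2 \<le> N (w + k)" if t: "0 < t" "t < 1" and lb: "R + r / 2 \<le> N (w + t *\<^sub>R k)" for t k
  proof -
    have "w + t *\<^sub>R k = (1 - t) *\<^sub>R w + t *\<^sub>R (w + k)" by (simp add: algebra_simps)
    then have "N (w + t *\<^sub>R k) \<le> (1 - t) * R + t * N (w + k)"
      using N_triangle[of "(1 - t) *\<^sub>R w" "t *\<^sub>R (w + k)"] t w by (simp add: N_scale)
    then have "r / 2 \<le> t * (N (w + k) - R)" using lb by (simp add: algebra_simps)
    moreover from this have "0 < t * (N (w + k) - R)" using r by linarith
    then have "t * (N (w + k) - R) \<le> 1 * (N (w + k) - R)"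
      using t by (intro mult_right_mono) (auto simp: zero_less_mult_iff)
    ultimately show ?thesis by simp
  qed
  have "R + r / 2 \<le> N (w + h)" using extend[OF s far(1)] .
  moreover have "R + r / 2 \<le> N (w - h)" using extend[of "1 - s" "- h"] s far(2) by simp
  moreover have "N (w + h) + N (w - h) \<le> 2 * R + e * N h"
  proof -
    have sc: "N (v /\<^sub>R R) = N v / R" for v using R(1) by (simp add: N_scale field_simps)
    have "N (w /\<^sub>R R + h /\<^sub>R R) + N (w /\<^sub>R R - h /\<^sub>R R) \<le> 2 + e * N (h /\<^sub>R R)"
    proof (rule \<delta>(2))
      show "N (w /\<^sub>R R) = 1" unfolding sc w using R(1) by simp
      show "N (h /\<^sub>R R) \<le> \<delta>" unfolding sc using R \<delta>(1) by (simp add: pos_divide_le_eq mult.commute)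
    qed
    then have "(N (w + h) + N (w - h)) / R \<le> (2 * R + e * N h) / R"
      using R(1) by (simp add: sc add_divide_distrib flip: scaleR_add_right scaleR_diff_right)
    then show ?thesis using R(1) by (simp add: divide_le_cancel)
  qed
  ultimately show False using e(2) r by linarith
qed

section \<open>Uniqueness on the segment towards a nearest point\<close>

text \<open>A competitor \<open>g\<close> forces equality in the triangle inequality for
  \<open>x - g = t *\<^sub>R (x - a) + (1 - t) *\<^sub>R B\<close>, where
  \<open>N B = N (x - a)\<close>. Strict convexity then gives \<open>B = x - a\<close>, that is
  \<open>g = a\<close>.\<close>

lemma toward_nearest_unique:
  assumes strict: "\<And>A B. N A = N B \<Longrightarrow> N ((1/2) *\<^sub>R (A + B)) = N A \<Longrightarrow> A = B"
    and a: "a \<in> G" "N (x - a) = N_dist G x" and g: "g \<in> G" and t: "0 < t" "t < 1/2"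
    and le: "N ((1 - t) *\<^sub>R x + t *\<^sub>R a - g) \<le> N ((1 - t) *\<^sub>R x + t *\<^sub>R a - a)"
  shows "g = a"
proof -
  define z where "z = (1 - t) *\<^sub>R x + t *\<^sub>R a"
  define d where "d = N (x - a)"
  define B where "B = (z - g) /\<^sub>R (1 - t)"
  define M where "M = (1/2) *\<^sub>R (x - a + B)"
  have za: "z - a = (1 - t) *\<^sub>R (x - a)" by (simp add: z_def algebra_simps)
  have zg: "z - g = (1 - t) *\<^sub>R B" using t by (simp add: B_def)
  have "(1 - t) * N B \<le> (1 - t) * d"
    using le t unfolding z_def[symmetric] za zg by (simp add: N_scale d_def)
  then have B_le: "N B \<le> d" using t by simp
  have "x - g = t *\<^sub>R (x - a) + (z - g)" by (simp add: z_def algebra_simps)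
  then have xg: "x - g = t *\<^sub>R (x - a) + (1 - t) *\<^sub>R B" by (simp add: zg)
  have far: "d \<le> N (x - g)" using N_dist_le[OF g] a(2) by (simp add: d_def)
  have "d \<le> t * d + (1 - t) * N B"
    using far N_triangle[of "t *\<^sub>R (x - a)" "(1 - t) *\<^sub>R B"] t unfolding xg by (simp add: N_scale d_def)
  then have "(1 - t) * d \<le> (1 - t) * N B" by (simp add: algebra_simps)
  then have "d \<le> N B" using t by simp
  with B_le have NB: "N B = d" by simp
  \<comment> \<open>Strict convexity is available for midpoints only, so \<open>x - g\<close> is
    rewritten as a combination of the midpoint \<open>M\<close> and \<open>B\<close>; its weight
    \<open>1 - 2 * t\<close> is positive because \<open>t < 1/2\<close>.\<close>
  have "(2 * t) *\<^sub>R M = t *\<^sub>R (x - a + B)" unfolding M_def scaleR_scaleR by simp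
  moreover have "1 - t = t + (1 - 2 * t)" by simp
  then have "(1 - t) *\<^sub>R B = t *\<^sub>R B + (1 - 2 * t) *\<^sub>R B" by (metis scaleR_add_left)
  ultimately have xg': "x - g = (2 * t) *\<^sub>R M + (1 - 2 * t) *\<^sub>R B"
    unfolding xg by (simp add: scaleR_add_right)
  then have "d \<le> 2 * t * N M + (1 - 2 * t) * d"
    using far N_triangle[of "(2 * t) *\<^sub>R M" "(1 - 2 * t) *\<^sub>R B"] t NB unfolding xg' by (simp add: N_scale)
  then have "2 * t * d \<le> 2 * t * N M" by (simp add: algebra_simps)
  then have "d \<le> N M" using t by simp
  moreover have "N M \<le> d"
    using N_triangle[of "x - a" B] N_scale[of "1/2" "x - a + B"] NB unfolding M_def d_def by simp
  ultimately have "x - a = B" using NB by (intro strict) (auto simp: M_def d_def)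
  then have "z - g = z - a" using za zg by simp
  then show ?thesis by simp
qed

end

subsection \<open>The product norm and the graph\<close>

lemma norm_powr_convex_comb:
  fixes a b :: "'a::real_normed_vector"
  assumes "1 < p" "0 \<le> t" "t \<le> 1"
  shows "norm ((1 - t) *\<^sub>R a + t *\<^sub>R b) powr p \<le> (1 - t) * norm a powr p + t * norm b powr p"
proof -
  have "norm ((1 - t) *\<^sub>R a + t *\<^sub>R b) \<le> (1 - t) * norm a + t * norm b"
    using norm_triangle_ineq[of "(1 - t) *\<^sub>R a" "t *\<^sub>R b"] assms by simp
  then have "norm ((1 - t) *\<^sub>R a + t *\<^sub>R b) powr p \<le> ((1 - t) * norm a + t * norm b) powr p"
    using assms by (intro powr_mono2) auto
  also have "\<dots> \<le> (1 - t) * norm a powr p + t * norm b powr p"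
    using assms by (intro powr_convex_comb) auto
  finally show ?thesis .
qed

text \<open>Strictness comes from the power when the norms differ, and from uniform convexity when
  they agree.\<close>

lemma norm_powr_midpoint_strict:
  fixes a b :: "'a::real_normed_vector"
  assumes uc: "uniformly_convex TYPE('a)" and p: "1 < p" and ab: "a \<noteq> b"
  shows "norm ((1/2) *\<^sub>R (a + b)) powr p < (norm a powr p + norm b powr p) / 2"
proof -
  have half: "norm ((1/2) *\<^sub>R (a + b)) = norm (a + b) / 2" unfolding norm_scaleR by simp
  have le: "norm (a + b) / 2 \<le> (norm a + norm b) / 2" using norm_triangle_ineq[of a b] by simp
  show ?thesis
  proof (cases "norm a = norm b")
    case False
    have "(norm (a + b) / 2) powr p \<le> ((norm a + norm b) / 2) powr p"
      using le p by (intro powr_mono2) auto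
    also have "\<dots> < (norm a powr p + norm b powr p) / 2"
      using False p by (intro powr_midpoint_strict) auto
    finally show ?thesis unfolding half .
  next
    case True
    have "0 < norm (a - b)" using ab by simp
    then obtain d where d: "d > 0" "\<And>x y :: 'a. \<lbrakk>norm x \<le> norm a + d; norm y \<le> norm a + d;
         norm a - d \<le> norm ((1/2) *\<^sub>R (x + y))\<rbrakk> \<Longrightarrow> norm (x - y) < norm (a - b)"
      using uniformly_convexD[OF uc norm_ge_zero[of a]] by blast
    have "\<not> norm a - d \<le> norm ((1/2) *\<^sub>R (a + b))"
    proof
      assume "norm a - d \<le> norm ((1/2) *\<^sub>R (a + b))"
      then have "norm (a - b) < norm (a - b)" using True d(1) by (intro d(2)) auto
      then show False by simp
    qed
    then have "norm (a + b) / 2 < norm a" using d(1) unfolding half by simp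
    then have "(norm (a + b) / 2) powr p < norm a powr p"
      using p by (intro powr_less_mono2) auto
    then show ?thesis unfolding half using True by simp
  qed
qed

section \<open>The l^p norm on the product\<close>

text \<open>The objective function is the \<open>p\<close>-th power of this norm of a difference, so
  its minimizers on the graph are the nearest points.\<close>

definition pnorm :: "real \<Rightarrow> 'a::real_normed_vector \<times> 'b::real_normed_vector \<Rightarrow> real" where
  "pnorm p z = (norm (fst z) powr p + norm (snd z) powr p) powr (1 / p)"

lemma pnorm_nonneg: "0 \<le> pnorm p z"
  by (simp add: pnorm_def)

lemma pnorm_powr: "1 < p \<Longrightarrow> pnorm p z powr p = norm (fst z) powr p + norm (snd z) powr p"
  by (simp add: pnorm_def powr_powr)

lemma powr_le_cancel:
  fixes x y p :: real
  assumes "1 < p" "0 \<le> y" "x powr p \<le> y powr p"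
  shows "x \<le> y"
  using assms powr_less_mono2[of p y x] by (meson less_trans linorder_not_le zero_less_one)

lemma norm_fst_le_pnorm: "1 < p \<Longrightarrow> norm (fst z) \<le> pnorm p z"
  by (rule powr_le_cancel[of p]) (simp_all add: pnorm_nonneg pnorm_powr)

lemma norm_snd_le_pnorm: "1 < p \<Longrightarrow> norm (snd z) \<le> pnorm p z"
  by (rule powr_le_cancel[of p]) (simp_all add: pnorm_nonneg pnorm_powr)

lemma pnorm_scale: "1 < p \<Longrightarrow> pnorm p (c *\<^sub>R z) = \<bar>c\<bar> * pnorm p z"
  by (simp add: pnorm_def powr_mult powr_powr flip: distrib_left)

lemma pnorm_le_1:
  "1 < p \<Longrightarrow> norm (fst z) powr p + norm (snd z) powr p \<le> 1 \<Longrightarrow> pnorm p z \<le> 1"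
  by (rule powr_le_cancel[of p]) (simp_all add: pnorm_powr)

lemma pnorm_eq_0_iff: "1 < p \<Longrightarrow> pnorm p z = 0 \<longleftrightarrow> z = 0"
  using norm_fst_le_pnorm[of p z] norm_snd_le_pnorm[of p z] by (auto simp: prod_eq_iff pnorm_def)

text \<open>Minkowski's inequality by normalization: convexity of the \<open>p\<close>-th powers
  keeps convex combinations of the unit vectors \<open>x'\<close> and \<open>y'\<close> in the unit
  ball, and \<open>x + y\<close> is \<open>r + s\<close> times the one with weights proportional to
  \<open>r\<close> and \<open>s\<close>.\<close>

lemma pnorm_triangle:
  fixes x y :: "'a::real_normed_vector \<times> 'b::real_normed_vector"
  assumes p: "1 < p"
  shows "pnorm p (x + y) \<le> pnorm p x + pnorm p y"
proof (cases "x = 0 \<or> y = 0")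
  case True
  then show ?thesis by (auto simp: pnorm_nonneg)
next
  case False
  define r s where "r = pnorm p x" and "s = pnorm p y"
  have rs: "r > 0" "s > 0"
    using False pnorm_eq_0_iff[OF p, of x] pnorm_eq_0_iff[OF p, of y] pnorm_nonneg[of p x] pnorm_nonneg[of p y]
    by (auto simp: r_def s_def less_le)
  define t where "t = s / (r + s)"
  have t: "0 \<le> t" "t \<le> 1" using rs by (auto simp: t_def)
  define x' y' where "x' = x /\<^sub>R r" and "y' = y /\<^sub>R s"
  have unit: "pnorm p x' = 1" "pnorm p y' = 1"
    using rs by (auto simp: x'_def y'_def pnorm_scale[OF p] r_def[symmetric] s_def[symmetric])
  have unit': "norm (fst x') powr p + norm (snd x') powr p = 1" "norm (fst y') powr p + norm (snd y') powr p = 1"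
    using pnorm_powr[OF p, of x'] pnorm_powr[OF p, of y'] unit by auto
  have "pnorm p ((1 - t) *\<^sub>R x' + t *\<^sub>R y') \<le> 1"
  proof (rule pnorm_le_1[OF p])
    have "norm (fst ((1 - t) *\<^sub>R x' + t *\<^sub>R y')) powr p + norm (snd ((1 - t) *\<^sub>R x' + t *\<^sub>R y')) powr p
       \<le> ((1 - t) * norm (fst x') powr p + t * norm (fst y') powr p)
         + ((1 - t) * norm (snd x') powr p + t * norm (snd y') powr p)"
      unfolding fst_add snd_add fst_scaleR snd_scaleR
      by (intro add_mono norm_powr_convex_comb p t)
    also have "\<dots> = (1 - t) * (norm (fst x') powr p + norm (snd x') powr p)
        + t * (norm (fst y') powr p + norm (snd y') powr p)"
      by (simp add: algebra_simps)
    also have "\<dots> = 1" by (simp add: unit')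
    finally show "norm (fst ((1 - t) *\<^sub>R x' + t *\<^sub>R y')) powr p + norm (snd ((1 - t) *\<^sub>R x' + t *\<^sub>R y')) powr p \<le> 1" .
  qed
  moreover have "(r + s) *\<^sub>R ((1 - t) *\<^sub>R x' + t *\<^sub>R y') = x + y"
  proof -
    have "(r + s) * (1 - t) = r" "(r + s) * t = s" using rs by (auto simp: t_def field_simps)
    then have "(r + s) * ((1 - t) * inverse r) = 1" "(r + s) * (t * inverse s) = 1"
      using rs by (simp_all flip: mult.assoc)
    then show ?thesis by (simp add: scaleR_add_right x'_def y'_def)
  qed
  then have "pnorm p (x + y) = (r + s) * pnorm p ((1 - t) *\<^sub>R x' + t *\<^sub>R y')"
    using pnorm_scale[OF p, of "r + s" "(1 - t) *\<^sub>R x' + t *\<^sub>R y'"] rs by simp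
  ultimately have "pnorm p (x + y) \<le> (r + s) * 1"
    using rs by (simp only:) (intro mult_left_mono; simp)
  then show ?thesis by (simp add: r_def s_def)
qed

lemma equivalent_norm_pnorm:
  assumes p: "1 < p"
  shows "equivalent_norm (pnorm p :: 'a::banach \<times> 'b::banach \<Rightarrow> real) 2"
proof
  fix z :: "'a \<times> 'b"
  have "norm z \<le> norm (fst z) + norm (snd z)" using norm_Pair_le[of "fst z" "snd z"] by simp
  then show "norm z \<le> 2 * pnorm p z"
    using norm_fst_le_pnorm[OF p, of z] norm_snd_le_pnorm[OF p, of z] by linarith
  have "z = (fst z, 0) + (0, snd z)" by simp
  then have "pnorm p z \<le> pnorm p (fst z, 0 :: 'b) + pnorm p (0 :: 'a, snd z)"
    using pnorm_triangle[OF p, of "(fst z, 0)" "(0, snd z)"] by simp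
  moreover have "pnorm p (fst z, 0 :: 'b) = norm (fst z)" "pnorm p (0 :: 'a, snd z) = norm (snd z)"
    using p by (auto simp: pnorm_def powr_powr)
  moreover have "norm (fst z) \<le> norm z" "norm (snd z) \<le> norm z"
    using norm_fst_le[of "fst z" "snd z"] norm_snd_le[of "snd z" "fst z"] by auto
  ultimately show "pnorm p z \<le> 2 * norm z" by linarith
qed (auto intro: pnorm_triangle p pnorm_scale)

text \<open>The midpoint inequality for \<open>p\<close>-th powers holds in each coordinate,
  strictly where the coordinates differ; equality of the sums leaves no room for a
  difference.\<close>

lemma pnorm_strict:
  fixes a b :: "'a::real_normed_vector \<times> 'b::real_normed_vector"
  assumes uc: "uniformly_convex TYPE('a)" "uniformly_convex TYPE('b)" and p: "1 < p"
    and eq: "pnorm p a = pnorm p b" "pnorm p ((1/2) *\<^sub>R (a + b)) = pnorm p a"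
  shows "a = b"
proof (rule ccontr)
  assume ne: "a \<noteq> b"
  define A B where "A = norm ((1/2) *\<^sub>R (fst a + fst b)) powr p"
    and "B = norm ((1/2) *\<^sub>R (snd a + snd b)) powr p"
  define A' B' where "A' = (norm (fst a) powr p + norm (fst b) powr p) / 2"
    and "B' = (norm (snd a) powr p + norm (snd b) powr p) / 2"
  have A: "fst a \<noteq> fst b \<Longrightarrow> A < A'" and B: "snd a \<noteq> snd b \<Longrightarrow> B < B'"
    unfolding A_def A'_def B_def B'_def by (intro norm_powr_midpoint_strict uc p; assumption)+
  have A2: "fst a = fst b \<Longrightarrow> A = A'" and B2: "snd a = snd b \<Longrightarrow> B = B'"
    by (auto simp: A_def A'_def B_def B'_def scaleR_2[symmetric])
  have "A + B = pnorm p a powr p"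
    using pnorm_powr[OF p, of "(1/2) *\<^sub>R (a + b)"] eq(2) by (simp add: A_def B_def scaleR_add_right)
  moreover have "pnorm p a powr p = norm (fst b) powr p + norm (snd b) powr p"
    using pnorm_powr[OF p, of b] eq(1) by simp
  then have "A' + B' = pnorm p a powr p"
    using pnorm_powr[OF p, of a] unfolding A'_def B'_def by argo
  ultimately have "A + B = A' + B'" by simp
  with A B A2 B2 ne show False by (cases "fst a = fst b"; cases "snd a = snd b") (auto simp: prod_eq_iff)
qed

text \<open>The estimates of \<open>powr_norm_smooth\<close> for the two coordinates add up to one
  for \<open>p\<close>-th powers.\<close>

lemma pnorm_smooth:
  fixes p e :: real
  assumes us: "uniformly_smooth TYPE('a::real_normed_vector)" "uniformly_smooth TYPE('b::real_normed_vector)"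
    and p: "1 < p" and e: "0 < e"
  shows "\<exists>\<delta>>0. \<forall>x y :: 'a \<times> 'b. pnorm p x = 1 \<longrightarrow> pnorm p y \<le> \<delta> \<longrightarrow>
           pnorm p (x + y) + pnorm p (x - y) \<le> 2 + e * pnorm p y"
proof -
  have e2: "e / 2 > 0" using e by simp
  obtain d1 where d1: "d1 > 0" "\<And>x k :: 'a. norm x \<le> 1 \<Longrightarrow> norm k \<le> d1 \<Longrightarrow>
     norm (x + k) powr p + norm (x - k) powr p \<le> 2 * norm x powr p + e / 2 * norm k"
    using powr_norm_smooth[OF us(1) p e2] by blast
  obtain d2 where d2: "d2 > 0" "\<And>x k :: 'b. norm x \<le> 1 \<Longrightarrow> norm k \<le> d2 \<Longrightarrow>
     norm (x + k) powr p + norm (x - k) powr p \<le> 2 * norm x powr p + e / 2 * norm k"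
    using powr_norm_smooth[OF us(2) p e2] by blast
  have "pnorm p (x + y) + pnorm p (x - y) \<le> 2 + e * pnorm p y"
    if x: "pnorm p x = 1" and y: "pnorm p y \<le> min d1 d2" for x y :: "'a \<times> 'b"
  proof -
    have ys: "norm (fst y) \<le> pnorm p y" "norm (snd y) \<le> pnorm p y"
      by (intro norm_fst_le_pnorm norm_snd_le_pnorm p)+
    have xs: "norm (fst x) \<le> 1" "norm (snd x) \<le> 1"
      using norm_fst_le_pnorm[OF p, of x] norm_snd_le_pnorm[OF p, of x] x by auto
    have x1: "norm (fst x) powr p + norm (snd x) powr p = 1"
      using pnorm_powr[OF p, of x] x by simp
    \<comment> \<open>The tangent of the power at 1 leads from \<open>p\<close>-th powers back to
      the norm itself.\<close>
    have bernoulli: "p * pnorm p z \<le> p + (norm (fst z) powr p + norm (snd z) powr p - 1)" for z :: "'a \<times> 'b"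
      using powr_tangent[OF p, of 1 "pnorm p z"] pnorm_nonneg[of p z] by (simp add: pnorm_powr[OF p] algebra_simps)
    have "norm (fst x + fst y) powr p + norm (fst x - fst y) powr p \<le> 2 * norm (fst x) powr p + e / 2 * norm (fst y)"
      using xs y ys by (intro d1(2)) auto
    moreover have "norm (snd x + snd y) powr p + norm (snd x - snd y) powr p \<le> 2 * norm (snd x) powr p + e / 2 * norm (snd y)"
      using xs y ys by (intro d2(2)) auto
    moreover have "e / 2 * norm (fst y) \<le> e / 2 * pnorm p y" "e / 2 * norm (snd y) \<le> e / 2 * pnorm p y"
      using ys e by (auto intro!: mult_left_mono)
    ultimately have "p * pnorm p (x + y) + p * pnorm p (x - y) \<le> 2 * p + e * pnorm p y"
      using bernoulli[of "x + y"] bernoulli[of "x - y"] x1 by simp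
    moreover have "e * pnorm p y \<le> p * (e * pnorm p y)"
      using mult_right_mono[of 1 p "e * pnorm p y"] p e pnorm_nonneg[of p y] by simp
    ultimately have "p * (pnorm p (x + y) + pnorm p (x - y)) \<le> p * (2 + e * pnorm p y)"
      by (simp add: algebra_simps)
    then show ?thesis using p by simp
  qed
  then show ?thesis using d1(1) d2(1) by (intro exI[of _ "min d1 d2"]) auto
qed

section \<open>The graph of the operator\<close>

text \<open>A minimizing sequence has a weakly convergent subsequence, whose limit lies on the graph
  by weak continuity of \<open>S\<close>. Minimality excludes a loss of norm in the limit, so the
  Kadec-Klee property makes the convergence strong in both factors.\<close>

lemma graph_approx_compact:
  fixes S :: "'u::banach \<Rightarrow> 'y::banach"
  assumes y: "uniformly_convex TYPE('y)" "uniformly_smooth TYPE('y)"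
    and u: "uniformly_convex TYPE('u)" "uniformly_smooth TYPE('u)"
    and p: "1 < p"
    and S: "\<And>(v :: nat \<Rightarrow> 'u) w. weakly_converges v w \<Longrightarrow> weakly_converges (\<lambda>n. S (v n)) (S w)"
  shows "equivalent_norm.approx_compact (pnorm p) (range (\<lambda>u. (S u, u)))"
proof -
  interpret equivalent_norm "pnorm p :: 'y \<times> 'u \<Rightarrow> real" 2
    by (rule equivalent_norm_pnorm[OF p])
  let ?G = "range (\<lambda>u. (S u, u))"
  show ?thesis
    unfolding approx_compact_def
  proof (intro allI impI)
    fix x :: "'y \<times> 'u" and g :: "nat \<Rightarrow> 'y \<times> 'u"
    assume gG: "\<forall>n. g n \<in> ?G" and lim: "(\<lambda>n. pnorm p (x - g n)) \<longlonglongrightarrow> N_dist ?G x"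
    define v where "v n = snd (g n)" for n
    have g: "g n = (S (v n), v n)" for n using gG[rule_format, of n] by (auto simp: v_def)
    obtain M where M: "\<And>n. pnorm p (x - g n) \<le> M"
      using Bseq_eq_bounded convergentI[OF lim, THEN convergent_imp_Bseq]
      unfolding Bseq_def by (metis abs_le_D1 real_norm_def)
    have M1: "norm (fst x - S (v n)) \<le> M" and M2: "norm (snd x - v n) \<le> M" for n
      using norm_fst_le_pnorm[OF p, of "x - g n"] norm_snd_le_pnorm[OF p, of "x - g n"] M[of n] by (auto simp: g)
    have "norm (v n) \<le> norm (snd x) + M" for n
      using norm_triangle_ineq2[of "v n" "snd x"] M2[of n] norm_minus_commute[of "snd x" "v n"] by linarith
    then obtain r w where r: "strict_mono (r :: nat \<Rightarrow> nat)" and w: "weakly_converges (\<lambda>n. v (r n)) w"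
      using weakly_convergent_subsequence[OF u] by metis
    \<comment> \<open>Pairing the two coordinate norms lets one extraction make both
      converge.\<close>
    define h where "h n = (norm (fst x - S (v (r n))), norm (snd x - v (r n)))" for n
    have "norm (h n) \<le> M + M" for n
      using norm_Pair_le[of "norm (fst x - S (v (r n)))" "norm (snd x - v (r n))"] M1[of "r n"] M2[of "r n"]
      by (simp add: h_def)
    then have "bounded (range h)" by (auto simp: bounded_iff)
    then obtain l s where s: "strict_mono (s :: nat \<Rightarrow> nat)" and l: "(h \<circ> s) \<longlonglongrightarrow> l"
      using bounded_imp_convergent_subsequence by blast
    define V where "V n = v (r (s n))" for n
    have V: "weakly_converges V w" unfolding V_def by (rule weakly_converges_subseq[OF w s])
    have wy: "weakly_converges (\<lambda>n. fst x - S (V n)) (fst x - S w)"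
      and wu: "weakly_converges (\<lambda>n. snd x - V n) (snd x - w)"
      by (intro weakly_converges_diff_const S V)+
    have ly: "(\<lambda>n. norm (fst x - S (V n))) \<longlonglongrightarrow> fst l" and lu: "(\<lambda>n. norm (snd x - V n)) \<longlonglongrightarrow> snd l"
      using tendsto_fst[OF l] tendsto_snd[OF l] by (auto simp: h_def V_def o_def)
    have le: "norm (fst x - S w) \<le> fst l" "norm (snd x - w) \<le> snd l"
      by (rule norm_weak_limit_le[OF y(2) wy ly], rule norm_weak_limit_le[OF u(2) wu lu])
    have rs: "strict_mono (\<lambda>n. r (s n))" using strict_mono_o[OF r s] by (simp add: o_def)
    have "(\<lambda>n. pnorm p (x - g (r (s n))) powr p) \<longlonglongrightarrow> N_dist ?G x powr p"
      using LIMSEQ_subseq_LIMSEQ[OF lim rs] p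
      by (intro tendsto_powr') (auto simp: o_def pnorm_nonneg)
    moreover have "pnorm p (x - g (r (s n))) powr p = norm (fst x - S (V n)) powr p + norm (snd x - V n) powr p" for n
      by (simp add: pnorm_powr[OF p] g V_def)
    ultimately have "(\<lambda>n. norm (fst x - S (V n)) powr p + norm (snd x - V n) powr p) \<longlonglongrightarrow> N_dist ?G x powr p"
      by simp
    moreover have "(\<lambda>n. norm (fst x - S (V n)) powr p + norm (snd x - V n) powr p) \<longlonglongrightarrow> fst l powr p + snd l powr p"
      using p by (intro tendsto_add tendsto_powr' ly lu tendsto_const) auto
    ultimately have "N_dist ?G x powr p = fst l powr p + snd l powr p" by (rule LIMSEQ_unique)
    moreover have "N_dist ?G x powr p \<le> pnorm p (x - (S w, w)) powr p"
      using p N_dist_le[of "(S w, w)" ?G x] N_dist_ge[of ?G 0 x] N_nonneg by (intro powr_mono2) auto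
    ultimately have sum: "fst l powr p + snd l powr p \<le> norm (fst x - S w) powr p + norm (snd x - w) powr p"
      by (simp add: pnorm_powr[OF p])
    have mono: "norm (fst x - S w) powr p \<le> fst l powr p" "norm (snd x - w) powr p \<le> snd l powr p"
      using le p by (auto intro!: powr_mono2)
    \<comment> \<open>Lower semicontinuity bounds each summand in one direction and minimality
      bounds the sum in the other, so both summands agree.\<close>
    have "fst l \<le> norm (fst x - S w)" "snd l \<le> norm (snd x - w)"
      by (rule powr_le_cancel[OF p norm_ge_zero]; use sum mono in linarith)+
    with le have "fst l = norm (fst x - S w)" "snd l = norm (snd x - w)" by auto
    then have "(\<lambda>n. fst x - S (V n)) \<longlonglongrightarrow> fst x - S w" "(\<lambda>n. snd x - V n) \<longlonglongrightarrow> snd x - w"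
      using kadec_klee[OF y wy] kadec_klee[OF u wu] ly lu by auto
    from tendsto_diff[OF tendsto_const[of "fst x"] this(1)] tendsto_diff[OF tendsto_const[of "snd x"] this(2)]
    have "(\<lambda>n. S (V n)) \<longlonglongrightarrow> S w" "V \<longlonglongrightarrow> w" by simp_all
    then have "(\<lambda>n. g (r (s n))) \<longlonglongrightarrow> (S w, w)"
      unfolding g V_def[symmetric] by (rule tendsto_Pair)
    then show "\<exists>l\<in>?G. \<exists>r. strict_mono r \<and> (\<lambda>n. g (r n)) \<longlonglongrightarrow> l"
      using rs by blast
  qed
qed

text \<open>A convex combination of graph points lies on the graph, and its second coordinate
  determines its first; so \<open>S\<close> preserves convex combinations. Subtracting
  \<open>S 0\<close> and rescaling extends this to all scalars and sums.\<close>

lemma affine_linear_if_convex_graph: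
  fixes S :: "'a::real_vector \<Rightarrow> 'b::real_vector"
  assumes "convex (range (\<lambda>u. (S u, u)))"
  shows "affine_linear S"
proof -
  have S: "S ((1 - t) *\<^sub>R a + t *\<^sub>R b) = (1 - t) *\<^sub>R S a + t *\<^sub>R S b" if "0 \<le> t" "t \<le> 1" for a b t
  proof -
    have "(1 - t) *\<^sub>R (S a, a) + t *\<^sub>R (S b, b) \<in> range (\<lambda>u. (S u, u))"
      using assms that unfolding convex_alt by blast
    then show ?thesis by auto
  qed
  define L where "L u = S u - S 0" for u
  have small: "L (t *\<^sub>R u) = t *\<^sub>R L u" if "0 \<le> t" "t \<le> 1" for t u
    using S[OF that, of 0 u] by (simp add: L_def algebra_simps)
  have pos: "L (t *\<^sub>R u) = t *\<^sub>R L u" if "0 \<le> t" for t u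
  proof (cases "t \<le> 1")
    case False
    then have "L ((1 / t) *\<^sub>R (t *\<^sub>R u)) = (1 / t) *\<^sub>R L (t *\<^sub>R u)" by (intro small) auto
    then have "t *\<^sub>R L u = t *\<^sub>R (1 / t) *\<^sub>R L (t *\<^sub>R u)" using False by simp
    then show ?thesis using False by simp
  qed (use that small in auto)
  have add: "L (a + b) = L a + L b" for a b
  proof -
    have "L (a + b) = L (2 *\<^sub>R ((1 - 1/2) *\<^sub>R a + (1/2) *\<^sub>R b))" by (simp flip: scaleR_add_right)
    also have "\<dots> = 2 *\<^sub>R L ((1 - 1/2) *\<^sub>R a + (1/2) *\<^sub>R b)" by (rule pos) simp
    also have "\<dots> = 2 *\<^sub>R ((1/2) *\<^sub>R S a + (1/2) *\<^sub>R S b - S 0)"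
      unfolding L_def by (subst S) auto
    also have "\<dots> = L a + L b" by (simp add: L_def algebra_simps scaleR_2)
    finally show ?thesis .
  qed
  have "L 0 = 0" by (simp add: L_def)
  then have neg: "L (- u) = - L u" for u
    using add[of "- u" u] by (simp add: eq_neg_iff_add_eq_0)
  have "L (t *\<^sub>R u) = t *\<^sub>R L u" for t u
  proof (cases "0 \<le> t")
    case False
    then show ?thesis using pos[of "- t" u] neg[of "t *\<^sub>R u"] by simp
  qed (rule pos)
  then have "linear L" by (intro linearI add)
  then show ?thesis unfolding affine_linear_def
    by (intro exI[of _ L] exI[of _ "S 0"]) (auto simp: L_def)
qed

section \<open>Two constant minimizers for converging data\<close>

theorem theorem2p4:
  fixes S :: "'u::banach \<Rightarrow> 'y::banach" and p :: real
  assumes "uniformly_convex TYPE('y)" and "uniformly_smooth TYPE('y)"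
    and "uniformly_convex TYPE('u)" and "uniformly_smooth TYPE('u)"
    and "1 < p"
    and "\<not> affine_linear S"
    and "\<And>(v :: nat \<Rightarrow> 'u) w. weakly_converges v w \<Longrightarrow> weakly_converges (\<lambda>n. S (v n)) (S w)"
  shows "\<exists>(y\<^sub>d :: 'y) (u\<^sub>d :: 'u)
          (yn :: nat \<Rightarrow> 'y) (un :: nat \<Rightarrow> 'u) (yn' :: nat \<Rightarrow> 'y) (un' :: nat \<Rightarrow> 'u)
          (ybar :: 'y) (ubar :: 'u) (ybar' :: 'y) (ubar' :: 'u).
      (\<lambda>n. (yn n, un n)) \<longlonglongrightarrow> (y\<^sub>d, u\<^sub>d) \<and>
      (\<lambda>n. (yn' n, un' n)) \<longlonglongrightarrow> (y\<^sub>d, u\<^sub>d) \<and>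
      (\<forall>n. {(ybar, ubar)} =
         argmin_set (\<lambda>(y, u). norm (y - yn n) powr p + norm (u - un n) powr p)
                    (\<lambda>(y, u). y = S u)) \<and>
      (\<forall>n. {(ybar', ubar')} =
         argmin_set (\<lambda>(y, u). norm (y - yn' n) powr p + norm (u - un' n) powr p)
                    (\<lambda>(y, u). y = S u)) \<and>
      (ybar, ubar) \<noteq> (ybar', ubar')"
proof -
  interpret equivalent_norm "pnorm p :: 'y \<times> 'u \<Rightarrow> real" 2
    by (rule equivalent_norm_pnorm) fact
  define G where "G = range (\<lambda>u. (S u, u))"
  have "approx_compact G"
    unfolding G_def by (rule graph_approx_compact) (fact assms)+
  moreover have "\<not> convex G"
    using affine_linear_if_convex_graph assms(6) unfolding G_def by blast
  moreover have "G \<noteq> {}" by (simp add: G_def)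
  ultimately have "\<not> unique_nearest G"
    using chebyshev_convex[OF pnorm_smooth[OF assms(2,4,5)]] by blast
  then obtain x a b where ab: "a \<in> G" "pnorm p (x - a) = N_dist G x" "b \<in> G" "pnorm p (x - b) = N_dist G x" "a \<noteq> b"
    unfolding unique_nearest_def by blast
  \<comment> \<open>The shift by 2 keeps \<open>t n\<close> at most 1/3, below the bound 1/2 of
    \<open>toward_nearest_unique\<close>.\<close>
  define t :: "nat \<Rightarrow> real" where "t n = inverse (real (Suc (n + 2)))" for n
  have t: "0 < t n" "t n < 1 / 2" for n by (auto simp: t_def field_simps)
  have t0: "t \<longlonglongrightarrow> 0"
    unfolding t_def by (rule LIMSEQ_ignore_initial_segment[OF LIMSEQ_inverse_real_of_nat])
  define z where "z c n = (1 - t n) *\<^sub>R x + t n *\<^sub>R c" for c n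
  have z_lim: "(\<lambda>n. (fst (z c n), snd (z c n))) \<longlonglongrightarrow> (fst x, snd x)" for c
  proof -
    have "z c \<longlonglongrightarrow> (1 - 0) *\<^sub>R x + 0 *\<^sub>R c"
      unfolding z_def by (intro tendsto_intros t0)
    then show ?thesis by simp
  qed
  have z_argmin: "{(fst c, snd c)} =
      argmin_set (\<lambda>(y, u). norm (y - fst (z c n)) powr p + norm (u - snd (z c n)) powr p) (\<lambda>(y, u). y = S u)"
    if c: "c \<in> G" "pnorm p (x - c) = N_dist G x" for c n
  proof -
    let ?f = "\<lambda>(y, u). norm (y - fst (z c n)) powr p + norm (u - snd (z c n)) powr p"
    have f: "?f g = pnorm p (z c n - g) powr p" for g
      by (simp add: pnorm_powr[OF assms(5)] norm_minus_commute split: prod.split)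
    have G: "(case g of (y, u) \<Rightarrow> y = S u) \<longleftrightarrow> g \<in> G" for g by (auto simp: G_def)
    \<comment> \<open>This gives uniqueness and, since values are comparable, also minimality of
      \<open>c\<close>: every other point of \<open>G\<close> has a larger value.\<close>
    have eq: "g = c" if "g \<in> G" "?f g \<le> ?f c" for g
    proof (rule toward_nearest_unique[OF _ c that(1) t])
      have "pnorm p (z c n - g) \<le> pnorm p (z c n - c)"
        by (rule powr_le_cancel[OF assms(5) pnorm_nonneg]) (use that(2) in \<open>unfold f\<close>)
      then show "pnorm p ((1 - t n) *\<^sub>R x + t n *\<^sub>R c - g) \<le> pnorm p ((1 - t n) *\<^sub>R x + t n *\<^sub>R c - c)"
        by (simp only: z_def)
    qed (rule pnorm_strict[OF assms(1,3,5)])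
    have "is_arg_min ?f (\<lambda>(y, u). y = S u) g \<longleftrightarrow> g = c" for g
    proof
      assume "is_arg_min ?f (\<lambda>(y, u). y = S u) g"
      then show "g = c" using eq c(1) unfolding is_arg_min_linorder G by blast
    next
      assume "g = c"
      then show "is_arg_min ?f (\<lambda>(y, u). y = S u) g"
        using eq c(1) unfolding is_arg_min_linorder G by (metis linear)
    qed
    then show ?thesis by (auto simp: argmin_set_def)
  qed
  show ?thesis
  proof (intro exI conjI allI)
    show "(\<lambda>n. (fst (z a n), snd (z a n))) \<longlonglongrightarrow> (fst x, snd x)"
      "(\<lambda>n. (fst (z b n), snd (z b n))) \<longlonglongrightarrow> (fst x, snd x)"
      by (rule z_lim)+
    show "{(fst a, snd a)} = argmin_set
        (\<lambda>(y, u). norm (y - fst (z a n)) powr p + norm (u - snd (z a n)) powr p) (\<lambda>(y, u). y = S u)" for n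
      by (rule z_argmin[OF ab(1,2)])
    show "{(fst b, snd b)} = argmin_set
        (\<lambda>(y, u). norm (y - fst (z b n)) powr p + norm (u - snd (z b n)) powr p) (\<lambda>(y, u). y = S u)" for n
      by (rule z_argmin[OF ab(3,4)])
    show "(fst a, snd a) \<noteq> (fst b, snd b)" using ab(5) by (simp add: prod_eq_iff)
  qed
qed

end
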